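(* There is $\varepsilon_0 > 0$ such that for every $0<\varepsilon < \varepsilon_0$ there are $n_0(\varepsilon)$ and $t_0(\varepsilon)$ such that for all $n > n_0(\varepsilon)$ the following holds. Let $t\ge1$ be an integer with $2n^{1-\varepsilon/7} \le t \le n- 2$ and $t > t_0(\varepsilon)$, and let $\mathcal{F}\subset \mathcal{T}_n$ be $t$-intersecting. Then there exist a $t$-intersecting family $\mathcal S$ of forests in $K_n$, each with at most $t + n^{1 - \varepsilon/6}$ edges, and a family $\mathcal{F}'\subset \mathcal{F}$ such that: (i) $\mathcal{F}\setminus \mathcal{F}'\subset \mathcal{T}_n[\mathcal{S}]$; (ii) for every $B\in \mathcal{S}$ there is a family $\mathcal{F}_B\subset \mathcal{F}$ such that $\mathcal{F}_B(B)$ is $10\varepsilon t$-spread; (iii) $|\mathcal{F}'|\le 2^{-\frac 12 n^{1-\varepsilon/4}}c_{n, t}\,n^{n-2-t}$.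
   Context: $\mathcal{T}_n$ is the set of labelled spanning trees of $K_n$ on $[n]$; all graphs are regarded as sets of edges of $K_n$. A family is $t$-intersecting if any two members share at least $t$ edges. For a family $\mathcal{G}$ and a set $X$: $\mathcal{G}(X) = \{A\setminus X: A\in\mathcal{G}, X\subset A\}$, $\mathcal{G}[X]=\{A\in\mathcal{G}: X\subset A\}$, and $\mathcal{G}[\mathcal{S}]=\bigcup_{X\in\mathcal{S}}\mathcal{G}[X]$. For $r>1$, a family $\mathcal{G}$ of edge sets is $r$-spread if $|\mathcal{G}(Y)|<r^{-|Y|}|\mathcal{G}|$ for every nonempty set of edges $Y$. $c_{n,t}$ is the largest product of $n-t$ positive integers with sum $n$. *)

theory Defs
  imports Complex_Main "HOL-Library.Ramsey"
begin

abbreviation K_edges :: "nat \<Rightarrow> nat set set" where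
  "K_edges n \<equiv> [{1..n}]\<^bsup>2\<^esup>"

(* The vertices of the cycle are listed in cyclic order, without repeating the first one. *)
definition is_cycle :: "'v set set \<Rightarrow> 'v list \<Rightarrow> bool" where
  "is_cycle E vs \<longleftrightarrow> length vs \<ge> 3 \<and> distinct vs \<and>
     (\<forall>i < length vs. {vs ! i, vs ! (Suc i mod length vs)} \<in> E)"

definition connects :: "'v set set \<Rightarrow> 'v set \<Rightarrow> bool" where
  "connects E V \<longleftrightarrow> (\<forall>u\<in>V. \<forall>v\<in>V. (u, v) \<in> {(x, y). {x, y} \<in> E}\<^sup>*)"

definition forests :: "nat \<Rightarrow> nat set set set" where
  "forests n = {E. E \<subseteq> K_edges n \<and> (\<nexists>vs. is_cycle E vs)}"

definition spanning_trees :: "nat \<Rightarrow> nat set set set" where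
  "spanning_trees n = {E \<in> forests n. connects E {1..n}}"

(* The two members are allowed to coincide, so every member has at least t elements. *)
definition t_intersecting :: "nat \<Rightarrow> 'a set set \<Rightarrow> bool" where
  "t_intersecting t \<G> \<longleftrightarrow> (\<forall>A\<in>\<G>. \<forall>B\<in>\<G>. t \<le> card (A \<inter> B))"

text \<open>For a family \<open>\<G>\<close>, the notations \<open>\<G>(X)\<close>, \<open>\<G>[X]\<close> and \<open>\<G>[\<S>]\<close> are rendered as
  \<open>fam_link \<G> X\<close>, \<open>fam_star \<G> X\<close> and \<open>fam_stars \<G> \<S>\<close>.\<close>

definition fam_link :: "'a set set \<Rightarrow> 'a set \<Rightarrow> 'a set set" where
  "fam_link \<G> X = {A - X | A. A \<in> \<G> \<and> X \<subseteq> A}"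

definition fam_star :: "'a set set \<Rightarrow> 'a set \<Rightarrow> 'a set set" where
  "fam_star \<G> X = {A \<in> \<G>. X \<subseteq> A}"

definition fam_stars :: "'a set set \<Rightarrow> 'a set set \<Rightarrow> 'a set set" where
  "fam_stars \<G> \<S> = (\<Union>X\<in>\<S>. fam_star \<G> X)"

(* U is the ground set; the strict inequality excludes the empty family (if U is nonempty). *)
definition spread :: "'a set \<Rightarrow> real \<Rightarrow> 'a set set \<Rightarrow> bool" where
  "spread U r \<G> \<longleftrightarrow> r > 1 \<and>
     (\<forall>Y. Y \<subseteq> U \<and> Y \<noteq> {} \<longrightarrow>
        real (card (fam_link \<G> Y)) < r powi (- int (card Y)) * real (card \<G>))"

definition c_max :: "nat \<Rightarrow> nat \<Rightarrow> nat" where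
  "c_max n t = Max {prod_list xs | xs :: nat list.
     length xs = n - t \<and> (\<forall>x \<in> set xs. x > 0) \<and> sum_list xs = n}"

end

theory Submission
  imports Defs
begin

text \<open>
  If \<open>\<S>\<close> covers \<open>\<F>\<close> and is \<open>u\<close>-intersecting with sets of size at most \<open>w\<close>, then \<open>\<F>\<close> splits into
  at most \<open>w choose u\<close> stars of \<open>u\<close>-subsets of a single member of \<open>\<S>\<close>. Inside each star one
  greedily removes spread pieces \<open>\<F>[B]\<close>; the process can only get stuck at a large \<open>B\<close>, and then
  what is left is small because few trees contain a large forest. Two centres \<open>B\<close>, \<open>B'\<close> of
  \<open>r\<close>-spread pieces satisfy \<open>|B \<inter> B'| \<ge> t - 2n/r\<close> by averaging.

  Starting from \<open>\<S> = \<F>\<close>, this step with \<open>r = \<surd>n\<close> lowers the maximal size of the centres one by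
  one down to \<open>t + n powr (1 - \<epsilon>/5)\<close>, while they stay \<open>(t - O(\<surd>n))\<close>-intersecting. A last step with
  \<open>r = 10 \<epsilon> t\<close> gives the centres of the theorem. They are exactly \<open>t\<close>-intersecting: the set
  \<open>B' - B\<close> is much smaller than \<open>r\<close>, so most members of the two spread pieces avoid the other
  centre, and a two-round version of the spread lemma finds two of them that are disjoint
  outside the centres.
\<close>

section \<open>Spread families\<close>

text \<open>A refinement step costs the binomial coefficient \<open>w choose u\<close>. A stuck
  forest with \<open>m\<close> edges beyond \<open>t\<close> repays about (2r/n)^m: each extra edge
  carries weight r, divides the number of trees by n and at most doubles \<open>c_max\<close>. This
  trade shapes both phases. With r = sqrt n each extra edge repays about sqrt n / 2. This beats the
  binomial coefficient as long as m is well above n^(3/4) and the old excess w - t is close to m,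
  which is why the size drops by one at a time. The price is 2n/r = 2 sqrt n lost common edges. With
  r = 10 \<epsilon> t, close to n, an extra edge may repay only a factor 2. This suffices once the
  excess M of the old centres satisfies M ln n << m, hence the gap between the exponents 1 -
  \<epsilon>/5 and 1 - \<epsilon>/6. Two final centres differ in about n^(1 - \<epsilon>/6) edges,
  which is below r because r \<ge> 20 \<epsilon> n^(1 - \<epsilon>/7). The exponent 1 - \<epsilon>/4
  of the error only has to stay below 1 - \<epsilon>/5. Two rounds suffice in the spread lemma
  because r is at least of order n^(3/4).\<close>

lemma sum_Pow_power_card:
  fixes x :: "'b::comm_semiring_1"
  assumes "finite A"
  shows "(\<Sum>B\<in>Pow A. x ^ card B * y ^ card (A - B)) = (x + y) ^ card A"
  using assms
proof (induction A rule: finite_induct)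
  case (insert a A)
  have inj: "inj_on (insert a) (Pow A)" using insert(2) by (auto simp: inj_on_def)
  have disj: "Pow A \<inter> insert a ` Pow A = {}" using insert(2) by auto
  have "(\<Sum>B\<in>Pow (insert a A). x ^ card B * y ^ card (insert a A - B))
     = (\<Sum>B\<in>Pow A. x ^ card B * y ^ card (insert a A - B))
       + (\<Sum>B\<in>Pow A. x ^ card (insert a B) * y ^ card (insert a A - insert a B))"
    using insert(1) inj disj
    by (simp add: Pow_insert sum.union_disjoint sum.reindex)
  also have "(\<Sum>B\<in>Pow A. x ^ card B * y ^ card (insert a A - B))
     = (\<Sum>B\<in>Pow A. y * (x ^ card B * y ^ card (A - B)))"
  proof (rule sum.cong)
    fix B assume "B \<in> Pow A"
    then have "insert a A - B = insert a (A - B)" "a \<notin> A - B" using insert(2) by auto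
    then show "x ^ card B * y ^ card (insert a A - B) = y * (x ^ card B * y ^ card (A - B))"
      using insert(1) by (simp add: algebra_simps)
  qed simp
  also have "(\<Sum>B\<in>Pow A. x ^ card (insert a B) * y ^ card (insert a A - insert a B))
     = (\<Sum>B\<in>Pow A. x * (x ^ card B * y ^ card (A - B)))"
  proof (rule sum.cong)
    fix B assume "B \<in> Pow A"
    then have "insert a A - insert a B = A - B" "a \<notin> B" "finite B"
      using insert(1,2) by (auto intro: finite_subset)
    then show "x ^ card (insert a B) * y ^ card (insert a A - insert a B)
        = x * (x ^ card B * y ^ card (A - B))"
      by (simp add: algebra_simps)
  qed simp
  finally show ?case
    using insert(1,2) by (simp add: sum_distrib_left[symmetric] insert(3) algebra_simps)
qed simp

text \<open>This is spreadness of the link \<open>fam_link H B\<close>, read on \<open>H\<close>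
  itself, without negative powers or a ground set. Sets \<open>Y\<close> meeting \<open>B\<close>
  can be left out: no member of the link contains them.\<close>

definition star_spread :: "real \<Rightarrow> 'a set \<Rightarrow> 'a set set \<Rightarrow> bool" where
  "star_spread r B H \<longleftrightarrow> finite H \<and> H \<noteq> {} \<and> (\<forall>A\<in>H. finite A \<and> B \<subseteq> A) \<and>
     (\<forall>Y. Y \<noteq> {} \<and> finite Y \<and> Y \<inter> B = {} \<longrightarrow> r ^ card Y * real (card (fam_star H Y)) < real (card H))"

lemma spread_fam_link:
  assumes H: "star_spread r B H" and r: "r > 1" and U: "finite U"
  shows "spread U r (fam_link H B)"
proof -
  have HB: "\<forall>A\<in>H. finite A \<and> B \<subseteq> A" and fH: "finite H" "H \<noteq> {}" using H by (auto simp: star_spread_def)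
  have "inj_on (\<lambda>A. A - B) H" using HB by (auto simp: inj_on_def)
  moreover have link: "fam_link H B = (\<lambda>A. A - B) ` H" using HB by (auto simp: fam_link_def)
  ultimately have cL: "card (fam_link H B) = card H" by (simp add: card_image)
  have pos: "0 < card H" using fH by (simp add: card_gt_0_iff)
  show ?thesis
    unfolding spread_def
  proof (intro conjI allI impI r)
    fix Y assume Y: "Y \<subseteq> U \<and> Y \<noteq> {}"
    have fY: "finite Y" using Y U finite_subset by blast
    have rY: "r powi (- int (card Y)) = 1 / r ^ card Y"
      by (simp add: power_int_minus divide_inverse)
    show "real (card (fam_link (fam_link H B) Y)) < r powi - int (card Y) * real (card (fam_link H B))"
    proof (cases "Y \<inter> B = {}")
      case False
      then have "fam_link (fam_link H B) Y = {}" unfolding link by (auto simp: fam_link_def)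
      then show ?thesis using pos r by (simp add: rY cL)
    next
      case True
      have "fam_link (fam_link H B) Y = (\<lambda>A. A - B - Y) ` fam_star H Y"
        unfolding link using True by (auto simp: fam_link_def fam_star_def image_iff)
      then have "card (fam_link (fam_link H B) Y) \<le> card (fam_star H Y)"
        using fH by (simp add: card_image_le fam_star_def)
      moreover have "r ^ card Y * real (card (fam_star H Y)) < real (card H)"
        using H Y fY True by (auto simp: star_spread_def)
      moreover have "r ^ card Y > 0" using r by simp
      ultimately have "r ^ card Y * real (card (fam_link (fam_link H B) Y)) < real (card H)"
        by (meson le_less_trans less_imp_le mult_left_mono of_nat_le_iff)
      then show ?thesis using r by (simp add: rY cL field_simps)
    qed
  qed
qed

text \<open>A set \<open>B\<close> of maximal size among those with
  \<open>|G| \<le> r\<^bsup>|B| - |T|\<^esup> |G[B]|\<close> has a spread star; remove that star and repeat.\<close>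

lemma spread_approximation:
  assumes "finite G" "\<And>A. A \<in> G \<Longrightarrow> finite A \<and> T \<subseteq> A" "r > (1::real)"
  shows "\<exists>S R. R \<subseteq> G \<and> (\<forall>A\<in>G - R. \<exists>B\<in>S. B \<subseteq> A) \<and>
     (\<forall>B\<in>S. T \<subseteq> B \<and> card B \<le> q \<and> (\<exists>H\<subseteq>G. star_spread r B H)) \<and>
     (R = {} \<or> (\<exists>B. T \<subseteq> B \<and> q < card B \<and> fam_star G B \<noteq> {} \<and>
        real (card R) \<le> r ^ (card B - card T) * real (card (fam_star G B))))"
  using assms(1,2)
proof (induction "card G" arbitrary: G rule: less_induct)
  case less
  show ?case
  proof (cases "G = {}")
    case True
    show ?thesis by (rule exI[of _ "{}"], rule exI[of _ "{}"]) (simp add: True)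
  next
    case False
    define good where "good B \<longleftrightarrow> B \<subseteq> \<Union>G \<and> T \<subseteq> B \<and>
      real (card G) \<le> r ^ (card B - card T) * real (card (fam_star G B))" for B
    have fU: "finite (\<Union>G)" using less.prems by auto
    have pos: "card G > 0" using False less.prems by (simp add: card_gt_0_iff)
    have "fam_star G T = G" using less.prems by (auto simp: fam_star_def)
    then have "good T" using False less.prems by (auto simp: good_def)
    moreover have "\<forall>B. good B \<longrightarrow> card B < Suc (card (\<Union>G))"
      using fU by (auto simp: good_def card_mono less_Suc_eq_le)
    ultimately obtain B where B: "good B" and Bmax: "\<And>B'. good B' \<Longrightarrow> card B' \<le> card B"
      using ex_has_greatest_nat[of good T card "Suc (card (\<Union>G))"] by blast
    have fB: "finite B" using B fU finite_subset good_def by metis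
    have TB: "T \<subseteq> B" using B by (simp add: good_def)
    have ne: "fam_star G B \<noteq> {}" using B pos by (auto simp: good_def)
    have sp: "star_spread r B (fam_star G B)"
      unfolding star_spread_def
    proof (intro conjI ballI allI impI)
      show "finite (fam_star G B)" using less.prems by (simp add: fam_star_def)
      show "fam_star G B \<noteq> {}" by (rule ne)
      fix Y assume Y: "Y \<noteq> {} \<and> finite Y \<and> Y \<inter> B = {}"
      have st: "fam_star (fam_star G B) Y = fam_star G (B \<union> Y)" by (auto simp: fam_star_def)
      show "r ^ card Y * real (card (fam_star (fam_star G B) Y)) < real (card (fam_star G B))"
      proof (cases "fam_star G (B \<union> Y) = {}")
        case True
        have "finite (fam_star G B)" using less.prems(1) by (simp add: fam_star_def)
        then show ?thesis using ne by (simp add: st True card_gt_0_iff)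
      next
        case nonempty: False
        have cBY: "card (B \<union> Y) = card B + card Y" using fB Y by (simp add: card_Un_disjoint Int_commute)
        have "card Y > 0" using Y by (simp add: card_gt_0_iff)
        \<comment> \<open>By maximality \<open>B \<union> Y\<close> is not good, and since it lies
          inside \<open>\<Union>G\<close> it is the inequality that fails. Dividing this by the
          inequality for \<open>B\<close> leaves exactly the spread condition.\<close>
        then have "\<not> good (B \<union> Y)" using Bmax cBY by fastforce
        moreover have "B \<union> Y \<subseteq> \<Union>G" using nonempty by (auto simp: fam_star_def)
        ultimately have lt: "r ^ (card (B \<union> Y) - card T) * real (card (fam_star G (B \<union> Y))) < real (card G)"
          using TB by (auto simp: good_def)
        have e: "card (B \<union> Y) - card T = (card B - card T) + card Y"
          using card_mono[OF fB TB] cBY by simp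
        have "r ^ (card B - card T) * (r ^ card Y * real (card (fam_star G (B \<union> Y))))
          < r ^ (card B - card T) * real (card (fam_star G B))"
          using lt B unfolding e power_add by (simp add: good_def mult.assoc)
        then show ?thesis using assms(3) by (simp add: st)
      qed
    qed (use less.prems in \<open>auto simp: fam_star_def\<close>)
    show ?thesis
    proof (cases "card B \<le> q")
      \<comment> \<open>The process is stuck: everything left becomes \<open>R\<close>, and goodness
        of \<open>B\<close> is the bound required of it.\<close>
      case False
      show ?thesis
        by (rule exI[of _ "{}"], rule exI[of _ G])
          (use False B TB ne in \<open>auto simp: good_def not_le\<close>)
    next
      case True
      let ?G = "G - fam_star G B"
      have "?G \<subset> G" using ne by (auto simp: fam_star_def)
      then have "card ?G < card G" using less.prems(1) by (rule psubset_card_mono[rotated])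
      moreover have "finite ?G" "\<And>A. A \<in> ?G \<Longrightarrow> finite A \<and> T \<subseteq> A" using less.prems by auto
      ultimately have "\<exists>S R. R \<subseteq> ?G \<and> (\<forall>A\<in>?G - R. \<exists>B\<in>S. B \<subseteq> A) \<and>
        (\<forall>B\<in>S. T \<subseteq> B \<and> card B \<le> q \<and> (\<exists>H\<subseteq>?G. star_spread r B H)) \<and>
        (R = {} \<or> (\<exists>B. T \<subseteq> B \<and> q < card B \<and> fam_star ?G B \<noteq> {} \<and>
           real (card R) \<le> r ^ (card B - card T) * real (card (fam_star ?G B))))"
        by (rule less.hyps)
      then obtain S R where SR:
        "R \<subseteq> ?G" "\<forall>A\<in>?G - R. \<exists>B\<in>S. B \<subseteq> A"
        "\<forall>B\<in>S. T \<subseteq> B \<and> card B \<le> q \<and> (\<exists>H\<subseteq>?G. star_spread r B H)"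
        "R = {} \<or> (\<exists>B. T \<subseteq> B \<and> q < card B \<and> fam_star ?G B \<noteq> {} \<and>
           real (card R) \<le> r ^ (card B - card T) * real (card (fam_star ?G B)))"
        by blast
      \<comment> \<open>Stars only grow from \<open>?G\<close> to \<open>G\<close>, so the bound on
        the leftover obtained for \<open>?G\<close> is also valid for \<open>G\<close>.\<close>
      have mono: "card (fam_star ?G B') \<le> card (fam_star G B')"
        "fam_star ?G B' \<noteq> {} \<Longrightarrow> fam_star G B' \<noteq> {}" for B'
        using less.prems(1) by (auto simp: fam_star_def intro!: card_mono)
      show ?thesis
      proof (rule exI[of _ "insert B S"], rule exI[of _ R], intro conjI)
        show "\<forall>A\<in>G - R. \<exists>B\<in>insert B S. B \<subseteq> A" using SR(2) by (auto simp: fam_star_def)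
        show "\<forall>B\<in>insert B S. T \<subseteq> B \<and> card B \<le> q \<and> (\<exists>H\<subseteq>G. star_spread r B H)"
        proof
          fix B' assume "B' \<in> insert B S"
          then consider "B' = B" | "B' \<in> S" by auto
          then show "T \<subseteq> B' \<and> card B' \<le> q \<and> (\<exists>H\<subseteq>G. star_spread r B' H)"
          proof cases
            case 1
            moreover have "fam_star G B \<subseteq> G" by (auto simp: fam_star_def)
            ultimately show ?thesis using sp TB True by blast
          next
            case 2
            then show ?thesis using SR(3) by (meson Diff_subset subset_trans)
          qed
        qed
        show "R = {} \<or> (\<exists>B. T \<subseteq> B \<and> q < card B \<and> fam_star G B \<noteq> {} \<and>
           real (card R) \<le> r ^ (card B - card T) * real (card (fam_star G B)))"
        proof (cases "R = {}")
          case False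
          then obtain B' where B': "T \<subseteq> B'" "q < card B'" "fam_star ?G B' \<noteq> {}"
            "real (card R) \<le> r ^ (card B' - card T) * real (card (fam_star ?G B'))"
            using SR(4) by auto
          have "real (card R) \<le> r ^ (card B' - card T) * real (card (fam_star G B'))"
            by (rule order_trans[OF B'(4)]) (use mono(1) assms(3) in \<open>auto intro!: mult_left_mono\<close>)
          then show ?thesis using B' mono(2) by blast
        qed simp
      qed (use SR(1) in auto)
    qed
  qed
qed

text \<open>Double counting of pairs (A, c). Spreadness enters only for singletons: an element
  outside \<open>B\<close> lies in less than a 1/r fraction of \<open>H\<close>, so a random member
  meets \<open>C\<close> outside \<open>B\<close> in at most |C|/r elements on average.\<close>

lemma star_spread_count_meeting:
  assumes H: "star_spread r B H" and r: "r > 0" and C: "finite C"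
  shows "r * (\<Sum>A\<in>H. real (card ((A - B) \<inter> C))) \<le> real (card C) * real (card H)"
proof -
  have fH: "finite H" using H by (simp add: star_spread_def)
  have "(\<Sum>A\<in>H. real (card ((A - B) \<inter> C))) = (\<Sum>A\<in>H. \<Sum>c\<in>C. if c \<in> A - B then 1 else 0)"
    by (rule sum.cong) (simp_all add: C sum.If_cases Int_commute Collect_mem_eq Int_def conj_commute)
  also have "\<dots> = (\<Sum>c\<in>C. \<Sum>A\<in>H. if c \<in> A - B then 1 else 0)" by (rule sum.swap)
  also have "\<dots> = (\<Sum>c\<in>C. real (card {A\<in>H. c \<in> A - B}))"
    by (rule sum.cong) (simp_all add: fH sum.If_cases Int_def)
  finally have "r * (\<Sum>A\<in>H. real (card ((A - B) \<inter> C))) = (\<Sum>c\<in>C. r * real (card {A\<in>H. c \<in> A - B}))"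
    by (simp add: sum_distrib_left)
  also have "\<dots> \<le> (\<Sum>c\<in>C. real (card H))"
  proof (rule sum_mono)
    fix c
    show "r * real (card {A \<in> H. c \<in> A - B}) \<le> real (card H)"
    proof (cases "c \<in> B")
      case False
      have "r ^ card {c} * real (card (fam_star H {c})) < real (card H)"
        using H False unfolding star_spread_def by blast
      then show ?thesis using False by (simp add: fam_star_def)
    qed simp
  qed
  finally show ?thesis by simp
qed

lemma star_spread_exists_small_meeting:
  assumes H: "star_spread r B H" and r: "r > 0" and C: "finite C"
  shows "\<exists>A\<in>H. real (card ((A - B) \<inter> C)) \<le> real (card C) / r"
proof (rule ccontr)
  assume "\<not> ?thesis"
  then have "\<forall>A\<in>H. real (card C) / r < real (card ((A - B) \<inter> C))" by auto
  then have "(\<Sum>A\<in>H. real (card C) / r) < (\<Sum>A\<in>H. real (card ((A - B) \<inter> C)))"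
    using H by (intro sum_strict_mono) (auto simp: star_spread_def)
  then show False using star_spread_count_meeting[OF assms] r by (simp add: field_simps)
qed

text \<open>Markov's inequality: the average meeting is at most 1/2, so at least half of the members
  have none.\<close>

lemma star_spread_count_avoiding:
  assumes H: "star_spread r B H" and r: "r > 0" and C: "finite C" "real (card C) \<le> r / 2"
  shows "real (card H) \<le> 2 * real (card {A\<in>H. (A - B) \<inter> C = {}})"
proof -
  have fH: "finite H" and fA: "\<And>A. A \<in> H \<Longrightarrow> finite A" using H by (auto simp: star_spread_def)
  let ?M = "{A\<in>H. (A - B) \<inter> C \<noteq> {}}" and ?N = "{A\<in>H. (A - B) \<inter> C = {}}"
  have "real (card ?M) = (\<Sum>A\<in>?M. 1)" by simp
  also have "\<dots> \<le> (\<Sum>A\<in>?M. real (card ((A - B) \<inter> C)))"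
    by (rule sum_mono) (use fA C in \<open>auto simp: Suc_le_eq card_gt_0_iff of_nat_le_iff[of 1, simplified]\<close>)
  also have "\<dots> \<le> (\<Sum>A\<in>H. real (card ((A - B) \<inter> C)))" by (rule sum_mono2) (use fH in auto)
  finally have "r * real (card ?M) \<le> r * (\<Sum>A\<in>H. real (card ((A - B) \<inter> C)))"
    using r by simp
  also have "\<dots> \<le> real (card C) * real (card H)" by (rule star_spread_count_meeting[OF H r C(1)])
  also have "\<dots> \<le> r / 2 * real (card H)" using C(2) by (rule mult_right_mono) simp
  finally have "2 * real (card ?M) \<le> real (card H)" using r by (simp add: field_simps)
  moreover have "card H = card ?M + card ?N"
    using fH by (subst card_Un_disjoint[symmetric]) (auto intro: arg_cong[where f=card])
  ultimately show ?thesis by simp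
qed

text \<open>The members are chosen one after the other: \<open>A2\<close> meets the centre
  \<open>B1\<close> in few elements outside \<open>B2\<close>, then \<open>A1\<close> meets the
  chosen \<open>A2\<close> in few elements outside \<open>B1\<close>. Each choice costs at most k/r,
  and the rest of the intersection lies in \<open>B1 \<inter> B2\<close>.\<close>

lemma star_spread_small_pair:
  assumes H1: "star_spread r B1 H1" and H2: "star_spread r B2 H2" and r: "r > 0"
    and k: "\<And>A. A \<in> H1 \<union> H2 \<Longrightarrow> card A \<le> k"
  shows "\<exists>A1\<in>H1. \<exists>A2\<in>H2. real (card (A1 \<inter> A2)) \<le> real (card (B1 \<inter> B2)) + 2 * real k / r"
proof -
  obtain A0 where "A0 \<in> H1" using H1 by (auto simp: star_spread_def)
  then have "finite A0" "B1 \<subseteq> A0" "card A0 \<le> k" using H1 k[of A0] by (auto simp: star_spread_def)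
  then have B1: "finite B1" "card B1 \<le> k"
    using finite_subset[of B1 A0] card_mono[of A0 B1] by auto
  obtain A2 where A2: "A2 \<in> H2" "real (card ((A2 - B2) \<inter> B1)) \<le> real (card B1) / r"
    using star_spread_exists_small_meeting[OF H2 r B1(1)] by auto
  have f2: "finite A2" "card A2 \<le> k" using A2(1) H2 k by (auto simp: star_spread_def)
  obtain A1 where A1: "A1 \<in> H1" "real (card ((A1 - B1) \<inter> A2)) \<le> real (card A2) / r"
    using star_spread_exists_small_meeting[OF H1 r f2(1)] by auto
  have "A1 \<inter> A2 \<subseteq> ((A1 - B1) \<inter> A2) \<union> (((A2 - B2) \<inter> B1) \<union> (B1 \<inter> B2))" by auto
  then have "card (A1 \<inter> A2) \<le> card (((A1 - B1) \<inter> A2) \<union> (((A2 - B2) \<inter> B1) \<union> (B1 \<inter> B2)))"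
    using f2 B1 by (intro card_mono) auto
  also have "\<dots> \<le> card ((A1 - B1) \<inter> A2) + (card ((A2 - B2) \<inter> B1) + card (B1 \<inter> B2))"
    by (meson card_Un_le add_left_mono order_trans)
  finally have "real (card (A1 \<inter> A2)) \<le> real (card ((A1 - B1) \<inter> A2)) + (real (card ((A2 - B2) \<inter> B1)) + real (card (B1 \<inter> B2)))"
    by (simp only: of_nat_add[symmetric] of_nat_le_iff)
  moreover have "real (card B1) / r \<le> real k / r" "real (card A2) / r \<le> real k / r"
    using B1 f2 r by (auto intro!: divide_right_mono)
  ultimately show ?thesis using A1 A2 by (intro bexI[of _ A1] bexI[of _ A2]) (auto simp: field_simps)
qed

section \<open>Disjoint members of spread families\<close>

text \<open>\<open>frag W i\<close> is a smallest set \<open>X j - W\<close> with \<open>X j \<subseteq> W \<union> X i\<close>. It can be recovered from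
  \<open>Z = W \<union> frag W i\<close> up to the choice of a subset of one canonical member \<open>X j \<subseteq> Z\<close>.\<close>

lemma fragment_generating_function_bound:
  fixes X :: "'i \<Rightarrow> 'a set" and q \<mu> \<rho> :: real
  assumes V: "finite V" and I: "finite I" and X: "\<And>i. i \<in> I \<Longrightarrow> X i \<subseteq> V \<and> card (X i) \<le> k"
    and sp: "\<And>Y. Y \<subseteq> V \<Longrightarrow> real (card {i\<in>I. Y \<subseteq> X i}) \<le> N * \<rho> ^ card Y"
    and nn: "q > 0" "\<mu> \<ge> 0" "\<rho> \<ge> 0" "N \<ge> 0"
  shows "\<exists>frag. (\<forall>W i. i \<in> I \<longrightarrow> frag W i \<subseteq> X i - W \<and> (\<exists>j\<in>I. X j \<subseteq> W \<union> frag W i)) \<and>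
     (\<Sum>W\<in>Pow V. q ^ card (V - W) * (\<Sum>i\<in>I. \<mu> ^ card (frag W i)))
       \<le> (1 + q * \<mu> * \<rho>) ^ k * N * (1 + q) ^ card V"
proof -
  define J where "J W i = (ARG_MIN (\<lambda>j. card (X j - W)) j. j \<in> I \<and> X j \<subseteq> W \<union> X i)" for W i
  have Jall: "(J W i \<in> I \<and> X (J W i) \<subseteq> W \<union> X i) \<and>
      (\<forall>j. j \<in> I \<and> X j \<subseteq> W \<union> X i \<longrightarrow> card (X (J W i) - W) \<le> card (X j - W))" if "i \<in> I" for W i
    unfolding J_def using that by (intro arg_min_nat_lemma[of _ i]) simp
  then have J: "\<And>W i. i \<in> I \<Longrightarrow> J W i \<in> I \<and> X (J W i) \<subseteq> W \<union> X i"
    and Jmin: "\<And>W i j. i \<in> I \<Longrightarrow> j \<in> I \<Longrightarrow> X j \<subseteq> W \<union> X i \<Longrightarrow> card (X (J W i) - W) \<le> card (X j - W)"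
    by blast+
  define frag where "frag W i = X (J W i) - W" for W i
  have frag1: "frag W i \<subseteq> X i - W" "X (J W i) \<subseteq> W \<union> frag W i" if "i \<in> I" for W i
    using J[OF that, of W] by (auto simp: frag_def)
  define A where "A Z = (SOME j. j \<in> I \<and> X j \<subseteq> Z)" for Z
  have A: "A Z \<in> I \<and> X (A Z) \<subseteq> Z" if "j \<in> I" "X j \<subseteq> Z" for j Z
    unfolding A_def using that by (intro someI[of "\<lambda>j. j \<in> I \<and> X j \<subseteq> Z" j]) simp
  \<comment> \<open>The value \<open>{}\<close> is a default for sets \<open>Z\<close> that contain
    no \<open>X j\<close>; it makes the bound by \<open>k\<close> valid for every
    \<open>Z\<close>.\<close>
  define AA where "AA Z = (if \<exists>j\<in>I. X j \<subseteq> Z then X (A Z) else {})" for Z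
  have AA: "AA Z \<subseteq> V" "card (AA Z) \<le> k" for Z
  proof -
    have "AA Z \<subseteq> V \<and> card (AA Z) \<le> k"
    proof (cases "\<exists>j\<in>I. X j \<subseteq> Z")
      case True
      then have "A Z \<in> I" using A by blast
      then show ?thesis using X True by (simp add: AA_def)
    qed (simp add: AA_def)
    then show "AA Z \<subseteq> V" "card (AA Z) \<le> k" by simp_all
  qed
  have fX: "finite (X i)" if "i \<in> I" for i using X[OF that] V finite_subset by blast
  \<comment> \<open>The canonical member inside \<open>?Z\<close> adds to \<open>W\<close> at most
    \<open>frag W i\<close>, and by minimality of the fragment no fewer elements. So the two
    coincide, although the choice of the member did not see \<open>W\<close> and
    \<open>i\<close>.\<close>
  have frag_AA: "frag W i \<subseteq> AA (W \<union> frag W i)" if i: "i \<in> I" for W i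
  proof -
    let ?Z = "W \<union> frag W i"
    have ex: "J W i \<in> I" "X (J W i) \<subseteq> ?Z" using J[OF i] frag1[OF i] by auto
    have AZ: "A ?Z \<in> I" "X (A ?Z) \<subseteq> ?Z" using A[OF ex] by auto
    have "X (A ?Z) - W \<subseteq> frag W i" using AZ by auto
    moreover have "X (A ?Z) \<subseteq> W \<union> X i" using AZ(2) frag1(1)[OF i, of W] by blast
    then have "card (frag W i) \<le> card (X (A ?Z) - W)"
      using Jmin[OF i AZ(1)] by (simp add: frag_def)
    moreover have "finite (frag W i)" using fX[OF ex(1)] by (simp add: frag_def)
    ultimately have "X (A ?Z) - W = frag W i" by (simp add: card_seteq)
    then show ?thesis using ex by (auto simp: AA_def)
  qed
  \<comment> \<open>The pair (W, i) is encoded as (Z, T, i) with T the fragment; W = Z - T makes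
    this injective. The weight q^|V - W| makes \<open>W\<close> a random set of density 1/(1 + q).
    As V - W is the disjoint union of V - Z and T, the weight splits and each element of T
    contributes q\<mu>. Spreadness then bounds the number of \<open>i\<close>, and the sum over T is
    a binomial sum.\<close>
  define D where "D = Sigma (Pow V) (\<lambda>Z. Sigma (Pow (AA Z)) (\<lambda>T. {i\<in>I. T \<subseteq> X i}))"
  define w where "w = (\<lambda>(Z, T, i::'i). q ^ card (V - Z) * (q * \<mu>) ^ card (T::'a set))"
  have fAA: "finite (AA Z)" for Z using AA(1) V finite_subset by blast
  have "(\<Sum>W\<in>Pow V. q ^ card (V - W) * (\<Sum>i\<in>I. \<mu> ^ card (frag W i)))
      = (\<Sum>(W, i)\<in>Pow V \<times> I. q ^ card (V - W) * \<mu> ^ card (frag W i))"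
    by (simp add: sum_distrib_left sum.cartesian_product)
  also have "\<dots> = (\<Sum>(W, i)\<in>Pow V \<times> I. w (W \<union> frag W i, frag W i, i))"
  proof (rule sum.cong)
    fix p assume "p \<in> Pow V \<times> I"
    then obtain W i where p: "p = (W, i)" "W \<subseteq> V" "i \<in> I" by auto
    have f: "frag W i \<subseteq> V - W" using frag1(1)[OF p(3)] X[OF p(3)] by auto
    then have "V - W = (V - (W \<union> frag W i)) \<union> frag W i" by auto
    moreover have "card ((V - (W \<union> frag W i)) \<union> frag W i) = card (V - (W \<union> frag W i)) + card (frag W i)"
      using V f by (intro card_Un_disjoint) (auto intro: finite_subset)
    ultimately have "card (V - W) = card (V - (W \<union> frag W i)) + card (frag W i)" by metis
    then show "(case p of (W, i) \<Rightarrow> q ^ card (V - W) * \<mu> ^ card (frag W i))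
      = (case p of (W, i) \<Rightarrow> w (W \<union> frag W i, frag W i, i))"
      by (simp add: p w_def power_add power_mult_distrib)
  qed simp
  also have "\<dots> = sum (w \<circ> (\<lambda>(W, i). (W \<union> frag W i, frag W i, i))) (Pow V \<times> I)"
    by (rule sum.cong) auto
  also have "\<dots> = sum w ((\<lambda>(W, i). (W \<union> frag W i, frag W i, i)) ` (Pow V \<times> I))"
  proof (rule sum.reindex[symmetric])
    show "inj_on (\<lambda>(W, i). (W \<union> frag W i, frag W i, i)) (Pow V \<times> I)"
    proof (rule inj_onI)
      fix p p' assume "p \<in> Pow V \<times> I" "p' \<in> Pow V \<times> I"
        and eq: "(\<lambda>(W, i). (W \<union> frag W i, frag W i, i)) p = (\<lambda>(W, i). (W \<union> frag W i, frag W i, i)) p'"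
      then obtain W W' i i' where p: "p = (W, i)" "p' = (W', i')" and i: "i \<in> I" "i' \<in> I" by blast
      have e: "i = i'" "W \<union> frag W i = W' \<union> frag W' i'" "frag W i = frag W' i'" using eq by (auto simp: p)
      have "W = (W \<union> frag W i) - frag W i" "W' = (W' \<union> frag W' i') - frag W' i'"
        using frag1(1)[OF i(1), of W] frag1(1)[OF i(2), of W'] by blast+
      then have "W = W'" using e(2,3) by metis
      then show "p = p'" by (simp add: p e(1))
    qed
  qed
  also have "\<dots> \<le> sum w D"
  proof (rule sum_mono2)
    show "finite D" unfolding D_def using V I fAA by (intro finite_SigmaI) auto
    show "(\<lambda>(W, i). (W \<union> frag W i, frag W i, i)) ` (Pow V \<times> I) \<subseteq> D"
    proof clarify
      fix W i assume W: "W \<subseteq> V" and i: "i \<in> I"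
      have "frag W i \<subseteq> X i" "X i \<subseteq> V" using frag1(1)[OF i, of W] X[OF i] by blast+
      then show "(W \<union> frag W i, frag W i, i) \<in> D"
        unfolding D_def using W i frag_AA[OF i, of W] by blast
    qed
  qed (use nn in \<open>auto simp: w_def\<close>)
  also have "\<dots> = (\<Sum>Z\<in>Pow V. \<Sum>T\<in>Pow (AA Z). \<Sum>i\<in>{i\<in>I. T \<subseteq> X i}. w (Z, T, i))"
    unfolding D_def using V I fAA by (simp add: sum.Sigma)
  also have "\<dots> = (\<Sum>Z\<in>Pow V. \<Sum>T\<in>Pow (AA Z). q ^ card (V - Z) * (q * \<mu>) ^ card T * real (card {i\<in>I. T \<subseteq> X i}))"
    by (simp add: w_def mult_ac)
  also have "\<dots> \<le> (\<Sum>Z\<in>Pow V. \<Sum>T\<in>Pow (AA Z). q ^ card (V - Z) * (q * \<mu>) ^ card T * (N * \<rho> ^ card T))"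
    using AA(1) nn by (intro sum_mono mult_left_mono sp) auto
  also have "\<dots> = (\<Sum>Z\<in>Pow V. N * q ^ card (V - Z) * (1 + q * \<mu> * \<rho>) ^ card (AA Z))"
  proof (rule sum.cong)
    fix Z
    have "(1 + q * \<mu> * \<rho>) ^ card (AA Z) = (\<Sum>T\<in>Pow (AA Z). (q * \<mu> * \<rho>) ^ card T)"
      using sum_Pow_power_card[OF fAA, of "q * \<mu> * \<rho>" 1] by (simp add: add.commute)
    then show "(\<Sum>T\<in>Pow (AA Z). q ^ card (V - Z) * (q * \<mu>) ^ card T * (N * \<rho> ^ card T)) =
         N * q ^ card (V - Z) * (1 + q * \<mu> * \<rho>) ^ card (AA Z)"
      by (simp add: sum_distrib_left power_mult_distrib mult_ac)
  qed simp
  also have "\<dots> \<le> (\<Sum>Z\<in>Pow V. N * q ^ card (V - Z) * (1 + q * \<mu> * \<rho>) ^ k)"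
    using nn AA(2) by (intro sum_mono mult_left_mono power_increasing) auto
  also have "\<dots> = (1 + q * \<mu> * \<rho>) ^ k * N * (1 + q) ^ card V"
    using sum_Pow_power_card[OF V, of 1 q]
    by (simp add: sum_distrib_right[symmetric] sum_distrib_left[symmetric] mult_ac)
  finally show ?thesis using frag1 J by (intro exI[of _ frag]) blast
qed

text \<open>A set \<open>W\<close> arises from 2^|W| pairs (W1, W - W1), each of weight 2^|U - W|,
  so every \<open>W\<close> gets the same total 2^|U|. In densities: 1/4 + 3/4 * 1/3 = 1/2.\<close>

lemma sum_Pow_split_two:
  fixes \<phi> :: "'a set \<Rightarrow> real"
  assumes U: "finite U"
  shows "(\<Sum>W1\<in>Pow U. \<Sum>W2\<in>Pow (U - W1). 2 ^ card (U - W1 - W2) * \<phi> (W1 \<union> W2))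
    = 2 ^ card U * (\<Sum>W\<in>Pow U. \<phi> W)"
proof -
  have "(\<Sum>W1\<in>Pow U. \<Sum>W2\<in>Pow (U - W1). 2 ^ card (U - W1 - W2) * \<phi> (W1 \<union> W2))
    = (\<Sum>(W1, W2)\<in>Sigma (Pow U) (\<lambda>W1. Pow (U - W1)). 2 ^ card (U - W1 - W2) * \<phi> (W1 \<union> W2))"
    using U by (simp add: sum.Sigma)
  also have "\<dots> = (\<Sum>(W, W1)\<in>Sigma (Pow U) Pow. 2 ^ card (U - W) * \<phi> W)"
  proof (rule sum.reindex_bij_witness[where i="\<lambda>(W, W1). (W1, W - W1)" and j="\<lambda>(W1, W2). (W1 \<union> W2, W1)"])
    fix p assume "p \<in> Sigma (Pow U) (\<lambda>W1. Pow (U - W1))"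
    then obtain W1 W2 where p: "p = (W1, W2)" "W1 \<subseteq> U" "W2 \<subseteq> U - W1" by blast
    have e: "W1 \<union> W2 - W1 = W2" "U - (W1 \<union> W2) = U - W1 - W2" using p by blast+
    show "(case case p of (W1, W2) \<Rightarrow> (W1 \<union> W2, W1) of (W, W1) \<Rightarrow> (W1, W - W1)) = p"
      by (simp add: p(1) e)
    show "(case p of (W1, W2) \<Rightarrow> (W1 \<union> W2, W1)) \<in> Sigma (Pow U) Pow"
      using p by auto
    show "(case case p of (W1, W2) \<Rightarrow> (W1 \<union> W2, W1) of (W, W1) \<Rightarrow> 2 ^ card (U - W) * \<phi> W)
      = (case p of (W1, W2) \<Rightarrow> 2 ^ card (U - W1 - W2) * \<phi> (W1 \<union> W2))"
      by (simp add: p(1) e)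
  qed auto
  also have "\<dots> = (\<Sum>W\<in>Pow U. \<Sum>W1\<in>Pow W. 2 ^ card (U - W) * \<phi> W)"
    using U by (subst sum.Sigma) (auto intro: finite_subset)
  also have "\<dots> = (\<Sum>W\<in>Pow U. 2 ^ card U * \<phi> W)"
  proof (rule sum.cong)
    fix W assume W: "W \<in> Pow U"
    then have "finite W" using U finite_subset by blast
    then have "card (Pow W) = 2 ^ card W" by (rule card_Pow)
    moreover have "card W + card (U - W) = card U" using W U by (metis PowD card_Diff_subset card_mono finite_subset le_add_diff_inverse)
    ultimately show "(\<Sum>W1\<in>Pow W. 2 ^ card (U - W) * \<phi> W) = 2 ^ card U * \<phi> W"
      by (simp add: power_add[symmetric] mult.assoc[symmetric])
  qed simp
  finally show ?thesis by (simp add: sum_distrib_left)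
qed

text \<open>Two rounds of exposure: a random \<open>W1\<close> of density 1/4 leaves small fragments, and a random
  \<open>W2\<close> of density 1/3 in the complement swallows one of them; \<open>W1 \<union> W2\<close> is a uniform subset.\<close>

lemma spread_few_subsets_without_member:
  fixes X :: "'i \<Rightarrow> 'a set" and \<rho> :: real
  assumes U: "finite U" and I: "finite I" "I \<noteq> {}" and X: "\<And>i. i \<in> I \<Longrightarrow> X i \<subseteq> U \<and> card (X i) \<le> k"
    and sp: "\<And>Y. Y \<subseteq> U \<Longrightarrow> real (card {i\<in>I. Y \<subseteq> X i}) \<le> real (card I) * \<rho> ^ card Y"
    and \<rho>: "\<rho> \<ge> 0" and h1: "20 * (1 + 6 * \<rho>) ^ k \<le> 2 ^ h" and h2: "(1 + 8 * \<rho>) ^ h \<le> 11 / 10"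
  shows "5 * real (card {W\<in>Pow U. \<forall>i\<in>I. \<not> X i \<subseteq> W}) \<le> 2 ^ card U"
proof -
  define miss where "miss W = (if \<forall>i\<in>I. \<not> X i \<subseteq> W then 1 else 0::real)" for W
  have miss01: "0 \<le> miss W" "miss W \<le> 1" for W by (auto simp: miss_def)
  have cI: "0 < real (card I)" using I by (simp add: card_gt_0_iff)
  obtain f where f0: "\<forall>W i. i \<in> I \<longrightarrow> f W i \<subseteq> X i - W \<and> (\<exists>j\<in>I. X j \<subseteq> W \<union> f W i)"
    and fsum: "(\<Sum>W\<in>Pow U. 3 ^ card (U - W) * (\<Sum>i\<in>I. 2 ^ card (f W i)))
       \<le> (1 + 6 * \<rho>) ^ k * real (card I) * 4 ^ card U"
    using fragment_generating_function_bound[OF U I(1) X sp, of 3 2] \<rho> by auto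
  have f: "\<And>W i. i \<in> I \<Longrightarrow> f W i \<subseteq> X i - W" "\<And>W i. i \<in> I \<Longrightarrow> \<exists>j\<in>I. X j \<subseteq> W \<union> f W i"
    using f0 by simp_all
  \<comment> \<open>A first-round set is bad if fewer than half of its fragments are smaller than
    \<open>h\<close>.\<close>
  define bad where "bad W \<longleftrightarrow> 2 * real (card {i\<in>I. card (f W i) < h}) < real (card I)" for W
  have bad_sum: "2 ^ h * real (card I) \<le> 2 * (\<Sum>i\<in>I. 2 ^ card (f W i))" if "bad W" for W
  proof -
    have "card I = card {i\<in>I. card (f W i) < h} + card {i\<in>I. h \<le> card (f W i)}"
      using I(1) by (subst card_Un_disjoint[symmetric]) (auto intro!: arg_cong[where f=card])
    then have "real (card I) \<le> 2 * real (card {i\<in>I. h \<le> card (f W i)})"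
      using that by (simp add: bad_def)
    then have "2 ^ h * real (card I) \<le> 2 * (2 ^ h * real (card {i\<in>I. h \<le> card (f W i)}))" by simp
    also have "2 ^ h * real (card {i\<in>I. h \<le> card (f W i)}) = (\<Sum>i\<in>{i\<in>I. h \<le> card (f W i)}. 2 ^ h)" by simp
    also have "\<dots> \<le> (\<Sum>i\<in>{i\<in>I. h \<le> card (f W i)}. 2 ^ card (f W i))"
      by (intro sum_mono power_increasing) auto
    also have "\<dots> \<le> (\<Sum>i\<in>I. 2 ^ card (f W i))" using I(1) by (intro sum_mono2) auto
    finally show ?thesis by simp
  qed
  \<comment> \<open>The average of 2^|fragment| over \<open>I\<close> is at least 2^h / 2 for a bad
    set, while over all sets it is at most (1 + 6\<rho>)^k \<le> 2^h / 20. By Markov bad sets have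
    at most a tenth of the total weight 4^|U|.\<close>
  have bad_total: "10 * (\<Sum>W\<in>{W\<in>Pow U. bad W}. 3 ^ card (U - W)) \<le> (4::real) ^ card U"
  proof -
    have "(2 ^ h * real (card I)) * (\<Sum>W\<in>{W\<in>Pow U. bad W}. 3 ^ card (U - W))
      = (\<Sum>W\<in>{W\<in>Pow U. bad W}. 3 ^ card (U - W) * (2 ^ h * real (card I)))"
      by (simp add: sum_distrib_left sum_distrib_right mult_ac)
    also have "\<dots> \<le> (\<Sum>W\<in>{W\<in>Pow U. bad W}. 3 ^ card (U - W) * (2 * (\<Sum>i\<in>I. 2 ^ card (f W i))))"
      using bad_sum by (intro sum_mono mult_left_mono) auto
    also have "\<dots> \<le> (\<Sum>W\<in>Pow U. 3 ^ card (U - W) * (2 * (\<Sum>i\<in>I. 2 ^ card (f W i))))"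
      using U by (intro sum_mono2) (auto intro!: mult_nonneg_nonneg sum_nonneg)
    also have "\<dots> = 2 * (\<Sum>W\<in>Pow U. 3 ^ card (U - W) * (\<Sum>i\<in>I. 2 ^ card (f W i)))"
      by (simp add: sum_distrib_left mult_ac)
    also have "\<dots> \<le> 2 * ((1 + 6 * \<rho>) ^ k * real (card I) * 4 ^ card U)" using fsum by simp
    finally have "real (card I) * (2 ^ h * (\<Sum>W\<in>{W\<in>Pow U. bad W}. 3 ^ card (U - W)))
       \<le> real (card I) * (2 * (1 + 6 * \<rho>) ^ k * 4 ^ card U)" by (simp add: mult_ac)
    then have "2 ^ h * (\<Sum>W\<in>{W\<in>Pow U. bad W}. 3 ^ card (U - W)) \<le> 2 * (1 + 6 * \<rho>) ^ k * 4 ^ card U"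
      using cI by simp
    also have "\<dots> \<le> (2 ^ h / 10) * 4 ^ card U" using h1 by (intro mult_right_mono) auto
    finally show ?thesis by simp
  qed
  have good_total: "10 * (\<Sum>W2\<in>Pow (U - W). 2 ^ card (U - W - W2) * miss (W \<union> W2)) \<le> 3 ^ card (U - W)"
    if good: "\<not> bad W" for W
  proof -
    let ?V = "U - W" and ?I = "{i\<in>I. card (f W i) < h}"
    have cI': "real (card I) \<le> 2 * real (card ?I)" using good by (simp add: bad_def)
    then have cI'pos: "0 < real (card ?I)" using cI by linarith
    \<comment> \<open>Keeping half of the indices loses a factor 2, which \<open>2 ^ card Y\<close>
      absorbs for nonempty \<open>Y\<close>. So \<rho> doubles, and the second round runs with 2 * 2
      * 2\<rho> = 8\<rho>.\<close>
    have sp': "real (card {i\<in>?I. Y \<subseteq> f W i}) \<le> real (card ?I) * (2 * \<rho>) ^ card Y" if Y: "Y \<subseteq> ?V" for Y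
    proof (cases "Y = {}")
      case False
      have "finite Y" using Y U finite_subset by blast
      then have "card Y \<noteq> 0" using False by simp
      then have two: "(2::real) \<le> 2 ^ card Y" using power_increasing[of 1 "card Y" "2::real"] by simp
      have "card {i\<in>?I. Y \<subseteq> f W i} \<le> card {i\<in>I. Y \<subseteq> X i}"
        using I(1) f(1) by (intro card_mono) auto
      then have "real (card {i\<in>?I. Y \<subseteq> f W i}) \<le> real (card I) * \<rho> ^ card Y"
        using sp[of Y] Y by force
      also have "\<dots> \<le> (2 * real (card ?I)) * \<rho> ^ card Y" using cI' \<rho> by (intro mult_right_mono) auto
      also have "\<dots> \<le> (2 ^ card Y * real (card ?I)) * \<rho> ^ card Y"
        using two \<rho> by (intro mult_right_mono) auto
      finally show ?thesis by (simp add: power_mult_distrib mult_ac)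
    qed simp
    have fV: "f W i \<subseteq> ?V \<and> card (f W i) \<le> h" if "i \<in> ?I" for i
    proof -
      have i: "i \<in> I" "card (f W i) < h" using that by simp_all
      then show ?thesis using f(1)[OF i(1), of W] X[OF i(1)] by auto
    qed
    have fin2: "finite ?V" "finite ?I" using U I(1) by simp_all
    obtain g where g0: "\<forall>W' i. i \<in> ?I \<longrightarrow> g W' i \<subseteq> f W i - W' \<and> (\<exists>j\<in>?I. f W j \<subseteq> W' \<union> g W' i)"
      and gsum0: "(\<Sum>W'\<in>Pow ?V. 2 ^ card (?V - W') * (\<Sum>i\<in>?I. 2 ^ card (g W' i)))
       \<le> (1 + 2 * 2 * (2 * \<rho>)) ^ h * real (card ?I) * (1 + 2) ^ card ?V"
      using fragment_generating_function_bound[OF fin2 fV sp', of 2 2] \<rho> by auto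
    have g: "\<exists>j\<in>?I. f W j \<subseteq> W' \<union> g W' i" and gsub: "g W' i \<subseteq> f W i - W'" if "i \<in> ?I" for W' i
      using g0[rule_format, OF that] by blast+
    have gsum: "(\<Sum>W'\<in>Pow ?V. 2 ^ card (?V - W') * (\<Sum>i\<in>?I. 2 ^ card (g W' i)))
       \<le> (1 + 8 * \<rho>) ^ h * real (card ?I) * 3 ^ card ?V"
      using gsum0 by simp
    have fin: "finite (g W' i)" if "i \<in> ?I" for W' i
    proof (rule finite_subset)
      show "g W' i \<subseteq> U" using gsub[OF that, of W'] fV[OF that] by blast
    qed (rule U)
    \<comment> \<open>An empty second fragment would put some \<open>f W j\<close> inside
      \<open>W'\<close> and hence some \<open>X l\<close> inside \<open>W \<union> W'\<close>. So a
      missing set has all second fragments nonempty, each of weight at least 2, while the average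
      weight is at most 11/10.\<close>
    have miss_sum: "real (card ?I) * (1 + miss (W \<union> W')) \<le> (\<Sum>i\<in>?I. 2 ^ card (g W' i))" for W'
    proof (cases "\<forall>i\<in>I. \<not> X i \<subseteq> W \<union> W'")
      case False
      have "real (card ?I) = (\<Sum>i\<in>?I. 1)" by simp
      also have "\<dots> \<le> (\<Sum>i\<in>?I. 2 ^ card (g W' i))" by (intro sum_mono) simp
      finally have "real (card ?I) \<le> (\<Sum>i\<in>?I. 2 ^ card (g W' i))" .
      moreover have "miss (W \<union> W') = 0" unfolding miss_def by (rule if_not_P) (rule False)
      ultimately show ?thesis by simp
    next
      case True
      have ne: "g W' i \<noteq> {}" if i: "i \<in> ?I" for i
      proof
        assume e: "g W' i = {}"
        obtain j where j: "j \<in> ?I" "f W j \<subseteq> W'" using g[OF i, of W'] by (auto simp: e)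
        obtain l where "l \<in> I" "X l \<subseteq> W \<union> f W j" using f(2)[of j W] j(1) by auto
        then show False using True j(2) by auto
      qed
      have "real (card ?I) * 2 = (\<Sum>i\<in>?I. 2)" by simp
      also have "\<dots> \<le> (\<Sum>i\<in>?I. 2 ^ card (g W' i))"
      proof (rule sum_mono)
        fix i assume i: "i \<in> ?I"
        have "1 \<le> card (g W' i)" using ne[OF i] fin[OF i] by (simp add: Suc_le_eq card_gt_0_iff)
        then have "(2::real) ^ 1 \<le> 2 ^ card (g W' i)" by (intro power_increasing) auto
        then show "(2::real) \<le> 2 ^ card (g W' i)" by simp
      qed
      finally have "real (card ?I) * 2 \<le> (\<Sum>i\<in>?I. 2 ^ card (g W' i))" .
      moreover have "miss (W \<union> W') = 1" unfolding miss_def by (rule if_P) (rule True)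
      ultimately show ?thesis by simp
    qed
    have "real (card ?I) * (\<Sum>W'\<in>Pow ?V. 2 ^ card (?V - W') * (1 + miss (W \<union> W')))
      = (\<Sum>W'\<in>Pow ?V. 2 ^ card (?V - W') * (real (card ?I) * (1 + miss (W \<union> W'))))"
      by (simp add: sum_distrib_left mult_ac)
    also have "\<dots> \<le> (\<Sum>W'\<in>Pow ?V. 2 ^ card (?V - W') * (\<Sum>i\<in>?I. 2 ^ card (g W' i)))"
      using miss_sum by (intro sum_mono mult_left_mono) auto
    also have "\<dots> \<le> real (card ?I) * ((1 + 8 * \<rho>) ^ h * 3 ^ card ?V)" using gsum by (simp add: mult_ac)
    finally have "(\<Sum>W'\<in>Pow ?V. 2 ^ card (?V - W') * (1 + miss (W \<union> W'))) \<le> (1 + 8 * \<rho>) ^ h * 3 ^ card ?V"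
      using cI'pos by simp
    also have "\<dots> \<le> 11 / 10 * 3 ^ card ?V" using h2 by (intro mult_right_mono) auto
    finally have "(\<Sum>W'\<in>Pow ?V. 2 ^ card (?V - W')) + (\<Sum>W'\<in>Pow ?V. 2 ^ card (?V - W') * miss (W \<union> W'))
      \<le> 11 / 10 * (3::real) ^ card ?V"
      by (simp add: algebra_simps sum.distrib)
    moreover have "(\<Sum>W'\<in>Pow ?V. 2 ^ card (?V - W')) = (3::real) ^ card ?V"
      using sum_Pow_power_card[of ?V "1::real" 2] U by simp
    ultimately show ?thesis by simp
  qed
  let ?w = "\<lambda>W. (\<Sum>W2\<in>Pow (U - W). 2 ^ card (U - W - W2) * miss (W \<union> W2))"
  have bad_w: "?w W \<le> 3 ^ card (U - W)" for W
  proof -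
    have "?w W \<le> (\<Sum>W2\<in>Pow (U - W). 2 ^ card (U - W - W2))"
      by (intro sum_mono) (use miss01 in auto)
    also have "\<dots> = 3 ^ card (U - W)" using sum_Pow_power_card[of "U - W" "1::real" 2] U by simp
    finally show ?thesis .
  qed
  \<comment> \<open>Bad sets are charged in full and good sets by a tenth of their weight. Each kind
    contributes at most 4^|U| / 10, which gives the final 1/5.\<close>
  have "10 * ?w W \<le> 10 * (if bad W then 3 ^ card (U - W) else 0) + 3 ^ card (U - W)" for W
  proof -
    have "(0::real) \<le> 3 ^ card (U - W)" by simp
    then have "10 * ?w W \<le> 10 * 3 ^ card (U - W) + 3 ^ card (U - W)" using bad_w[of W] by linarith
    then show ?thesis using good_total[of W] by (cases "bad W") simp_all
  qed
  then have "(\<Sum>W\<in>Pow U. 10 * ?w W) \<le> (\<Sum>W\<in>Pow U. 10 * (if bad W then 3 ^ card (U - W) else 0) + 3 ^ card (U - W))"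
    by (intro sum_mono)
  also have "\<dots> = 10 * (\<Sum>W\<in>{W\<in>Pow U. bad W}. 3 ^ card (U - W)) + (\<Sum>W\<in>Pow U. 3 ^ card (U - W))"
  proof -
    have fP: "finite (Pow U)" using U by simp
    show ?thesis by (simp only: sum.distrib sum_distrib_left[symmetric] sum.inter_filter[OF fP])
  qed
  also have "(\<Sum>W\<in>Pow U. 3 ^ card (U - W)) = (4::real) ^ card U"
    using sum_Pow_power_card[of U "1::real" 3] U by simp
  finally have "10 * (\<Sum>W\<in>Pow U. ?w W) \<le> 2 * 4 ^ card U"
    using bad_total by (simp add: sum_distrib_left)
  then have "5 * (2 ^ card U * (\<Sum>W\<in>Pow U. miss W)) \<le> 4 ^ card U"
    unfolding sum_Pow_split_two[OF U] by linarith
  also have "(4::real) ^ card U = 2 ^ card U * 2 ^ card U" by (simp add: power_mult_distrib[symmetric])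
  finally have "5 * (\<Sum>W\<in>Pow U. miss W) \<le> 2 ^ card U" by (simp add: mult.left_commute)
  moreover have "(\<Sum>W\<in>Pow U. miss W) = real (card {W\<in>Pow U. \<forall>i\<in>I. \<not> X i \<subseteq> W})"
    using U by (simp add: miss_def sum.If_cases Int_def)
  ultimately show ?thesis by simp
qed

text \<open>A uniform subset \<open>W\<close> of \<open>U\<close> and its complement have the same
  distribution. \<open>W\<close> contains some \<open>X i\<close>, and U - W some
  \<open>X' j\<close>, each with probability at least 4/5, so both happen for some
  \<open>W\<close>.\<close>

lemma spread_disjoint_pair:
  fixes X :: "'i \<Rightarrow> 'a set" and X' :: "'j \<Rightarrow> 'a set" and \<rho> :: real
  assumes U: "finite U"
    and I: "finite I" "I \<noteq> {}" "\<And>i. i \<in> I \<Longrightarrow> X i \<subseteq> U \<and> card (X i) \<le> k"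
      "\<And>Y. Y \<subseteq> U \<Longrightarrow> real (card {i\<in>I. Y \<subseteq> X i}) \<le> real (card I) * \<rho> ^ card Y"
    and J: "finite J" "J \<noteq> {}" "\<And>j. j \<in> J \<Longrightarrow> X' j \<subseteq> U \<and> card (X' j) \<le> k"
      "\<And>Y. Y \<subseteq> U \<Longrightarrow> real (card {j\<in>J. Y \<subseteq> X' j}) \<le> real (card J) * \<rho> ^ card Y"
    and \<rho>: "\<rho> \<ge> 0" "20 * (1 + 6 * \<rho>) ^ k \<le> 2 ^ h" "(1 + 8 * \<rho>) ^ h \<le> 11 / 10"
  shows "\<exists>i\<in>I. \<exists>j\<in>J. X i \<inter> X' j = {}"
proof (rule ccontr)
  assume no: "\<not> ?thesis"
  let ?P = "{W\<in>Pow U. \<forall>i\<in>I. \<not> X i \<subseteq> W}" and ?Q = "{W\<in>Pow U. \<forall>j\<in>J. \<not> X' j \<subseteq> W}"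
  have "Pow U \<subseteq> ?P \<union> (\<lambda>W. U - W) ` ?Q"
  proof
    fix W assume W: "W \<in> Pow U"
    have "U - W \<in> ?Q" if "W \<notin> ?P"
    proof -
      obtain i where i: "i \<in> I" "X i \<subseteq> W" using \<open>W \<notin> ?P\<close> W by blast
      have "\<not> X' j \<subseteq> U - W" if "j \<in> J" for j
      proof -
        have "X i \<inter> X' j \<noteq> {}" using no i(1) that by blast
        then show ?thesis using i(2) by blast
      qed
      then show ?thesis by blast
    qed
    moreover have "W = U - (U - W)" using W by auto
    ultimately show "W \<in> ?P \<union> (\<lambda>W. U - W) ` ?Q" by blast
  qed
  then have "card (Pow U) \<le> card (?P \<union> (\<lambda>W. U - W) ` ?Q)" using U by (intro card_mono) auto
  also have "\<dots> \<le> card ?P + card ?Q"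
    using card_Un_le[of ?P "(\<lambda>W. U - W) ` ?Q"] card_image_le[of ?Q "\<lambda>W. U - W"] U by simp
  finally have "real (2 ^ card U) \<le> real (card ?P + card ?Q)"
    using U by (simp only: card_Pow of_nat_le_iff)
  then have "2 ^ card U \<le> real (card ?P) + real (card ?Q)" by simp
  moreover have "5 * real (card ?P) \<le> 2 ^ card U"
    using spread_few_subsets_without_member[OF U I \<rho>] .
  moreover have "5 * real (card ?Q) \<le> 2 ^ card U"
    using spread_few_subsets_without_member[OF U J \<rho>] .
  moreover have "(0::real) < 2 ^ card U" by simp
  ultimately show False by linarith
qed

section \<open>Spanning trees containing a forest\<close>

abbreviation edge_rel :: "'v set set \<Rightarrow> ('v \<times> 'v) set" where
  "edge_rel E \<equiv> {(x, y). {x, y} \<in> E}"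

lemma edge_rel_rtrancl_sym: "(x, y) \<in> (edge_rel E)\<^sup>* \<Longrightarrow> (y, x) \<in> (edge_rel E)\<^sup>*"
proof -
  have "sym (edge_rel E)" by (auto simp: sym_def insert_commute)
  then show "(x, y) \<in> (edge_rel E)\<^sup>* \<Longrightarrow> (y, x) \<in> (edge_rel E)\<^sup>*" by (meson sym_rtrancl symD)
qed

lemma rtrancl_imp_distinct_path:
  "(x, y) \<in> R\<^sup>* \<Longrightarrow> \<exists>vs. vs \<noteq> [] \<and> distinct vs \<and> hd vs = x \<and> last vs = y \<and> successively (\<lambda>a b. (a, b) \<in> R) vs"
proof (induction rule: converse_rtrancl_induct)
  case base
  show ?case by (rule exI[of _ "[y]"]) simp
next
  case (step x z)
  then obtain vs where vs: "vs \<noteq> []" "distinct vs" "hd vs = z" "last vs = y" "successively (\<lambda>a b. (a, b) \<in> R) vs"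
    by auto
  show ?case
  proof (cases "x \<in> set vs")
    case True
    then obtain us ws where s: "vs = us @ x # ws" by (meson split_list)
    show ?thesis
      by (rule exI[of _ "x # ws"]) (use vs s in \<open>auto simp: successively_append_iff\<close>)
  next
    case False
    show ?thesis
      by (rule exI[of _ "x # vs"]) (use vs step(1) False in \<open>auto simp: successively_Cons\<close>)
  qed
qed

text \<open>A simple path from \<open>x\<close> to \<open>y\<close> avoiding the edge is closed by
  it to a cycle. The path has at least three vertices, since one with two would be the removed edge
  itself.\<close>

lemma acyclic_edge_separates:
  assumes "\<nexists>vs. is_cycle E vs" "{x, y} \<in> E" "x \<noteq> y"
  shows "(x, y) \<notin> (edge_rel (E - {{x, y}}))\<^sup>*"
proof
  assume "(x, y) \<in> (edge_rel (E - {{x, y}}))\<^sup>*"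
  then obtain vs where vs: "vs \<noteq> []" "distinct vs" "hd vs = x" "last vs = y"
    "successively (\<lambda>a b. (a, b) \<in> edge_rel (E - {{x, y}})) vs"
    using rtrancl_imp_distinct_path by metis
  have len: "length vs \<ge> 3"
  proof (rule ccontr)
    assume "\<not> 3 \<le> length vs"
    moreover have "length vs \<noteq> 0" using vs(1) by simp
    ultimately have "length vs = 1 \<or> length vs = 2" by linarith
    then consider a where "vs = [a]" | a b where "vs = [a, b]"
      by (auto simp: length_Suc_conv numeral_2_eq_2)
    then show False using vs assms(3) by cases auto
  qed
  have nth: "{vs ! i, vs ! Suc i} \<in> E" if "Suc i < length vs" for i
    using vs(5) that by (auto simp: successively_conv_nth)
  have "{vs ! i, vs ! (Suc i mod length vs)} \<in> E" if i: "i < length vs" for i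
  proof (cases "Suc i < length vs")
    case True
    then show ?thesis using nth by simp
  next
    case False
    then have "Suc i = length vs" using i by simp
    moreover from this have "vs ! i = y" using vs(1,4) by (metis diff_Suc_1 last_conv_nth)
    moreover have "vs ! 0 = x" using vs(1,3) by (simp add: hd_conv_nth)
    ultimately show ?thesis using assms(2) by (simp add: insert_commute)
  qed
  then have "is_cycle E vs" using len vs(2) by (simp add: is_cycle_def)
  then show False using assms(1) by blast
qed

text \<open>The least vertex is the canonical representative of a component. In a spanning tree it
  is 1, so all trees are rooted at 1 without a choice.\<close>

definition comp_root :: "nat set set \<Rightarrow> nat \<Rightarrow> nat" where
  "comp_root E v = (LEAST w. (v, w) \<in> (edge_rel E)\<^sup>*)"

lemma comp_root_connected: "(v, comp_root E v) \<in> (edge_rel E)\<^sup>*"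
  unfolding comp_root_def by (rule LeastI[of _ v]) simp

lemma comp_root_le: "(v, w) \<in> (edge_rel E)\<^sup>* \<Longrightarrow> comp_root E v \<le> w"
  unfolding comp_root_def by (rule Least_le)

lemma comp_root_eq: 
  assumes "(v, w) \<in> (edge_rel E)\<^sup>*"
  shows "comp_root E v = comp_root E w"
proof -
  have "(v, u) \<in> (edge_rel E)\<^sup>* \<longleftrightarrow> (w, u) \<in> (edge_rel E)\<^sup>*" for u
    using assms edge_rel_rtrancl_sym[OF assms] by (meson rtrancl_trans)
  then show ?thesis by (simp add: comp_root_def)
qed

lemma comp_root_idem: "comp_root E (comp_root E v) = comp_root E v"
  using comp_root_eq[OF comp_root_connected, of E v] by simp

lemma K_edges_rtrancl_in:
  assumes "E \<subseteq> K_edges n" "(v, w) \<in> (edge_rel E)\<^sup>*" "v \<in> {1..n}"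
  shows "w \<in> {1..n}"
  using assms(2,3)
proof (induction rule: rtrancl_induct)
  case (step y z)
  then have "{y, z} \<in> K_edges n" using assms(1) by blast
  then show ?case by simp
qed simp

lemma comp_root_in: "E \<subseteq> K_edges n \<Longrightarrow> v \<in> {1..n} \<Longrightarrow> comp_root E v \<in> {1..n}"
  by (rule K_edges_rtrancl_in[OF _ comp_root_connected])

definition root_dist :: "nat set set \<Rightarrow> nat \<Rightarrow> nat" where
  "root_dist E v = (LEAST k. (v, comp_root E v) \<in> edge_rel E ^^ k)"

lemma root_dist_path: "(v, comp_root E v) \<in> edge_rel E ^^ root_dist E v"
proof -
  obtain k where "(v, comp_root E v) \<in> edge_rel E ^^ k"
    using comp_root_connected rtrancl_power by blast
  then show ?thesis unfolding root_dist_def by (rule LeastI)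
qed

lemma root_dist_le: "(v, comp_root E v) \<in> edge_rel E ^^ k \<Longrightarrow> root_dist E v \<le> k"
  unfolding root_dist_def by (rule Least_le)

lemma parent_exists:
  assumes "comp_root E v \<noteq> v"
  shows "\<exists>p. {v, p} \<in> E \<and> root_dist E p < root_dist E v \<and> comp_root E p = comp_root E v"
proof -
  obtain k where k: "root_dist E v = Suc k"
    using root_dist_path[of v E] assms by (cases "root_dist E v") auto
  then obtain p where p: "(v, p) \<in> edge_rel E" "(p, comp_root E v) \<in> edge_rel E ^^ k"
    using root_dist_path[of v E] by (metis relpow_Suc_D2)
  have "comp_root E v = comp_root E p" using p(1) by (intro comp_root_eq) auto
  then show ?thesis using p k root_dist_le[of p E k] by (intro exI[of _ p]) auto
qed

text \<open>A neighbour nearer to the root. A root has distance 0 and thus no such neighbour; the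
  value there is arbitrary, so the facts about \<open>parent\<close> are stated for
  non-roots.\<close>

definition parent :: "nat set set \<Rightarrow> nat \<Rightarrow> nat" where
  "parent E v = (SOME p. {v, p} \<in> E \<and> root_dist E p < root_dist E v \<and> comp_root E p = comp_root E v)"

lemma parent:
  assumes "comp_root E v \<noteq> v"
  shows "{v, parent E v} \<in> E" "root_dist E (parent E v) < root_dist E v"
    "comp_root E (parent E v) = comp_root E v"
  using someI_ex[OF parent_exists[OF assms]] unfolding parent_def by auto

text \<open>If both ends had the same parent edge, each would be nearer to the root than the
  other.\<close>

lemma parent_edge_inj: "inj_on (\<lambda>v. {v, parent E v}) {v. comp_root E v \<noteq> v}"
proof (rule inj_onI)
  fix v w assume v: "v \<in> {v. comp_root E v \<noteq> v}" "w \<in> {v. comp_root E v \<noteq> v}"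
    and e: "{v, parent E v} = {w, parent E w}"
  show "v = w"
  proof (rule ccontr)
    assume "v \<noteq> w"
    then have "parent E v = w" "parent E w = v" using e by (auto simp: doubleton_eq_iff)
    then show False using parent(2)[of E v] parent(2)[of E w] v by simp
  qed
qed

text \<open>The parent edges already join every vertex to its root. A further edge would have its
  ends connected without it, which acyclicity forbids.\<close>

lemma forest_eq_parent_edges:
  assumes E: "E \<in> forests n"
  shows "E = (\<lambda>v. {v, parent E v}) ` {v\<in>{1..n}. comp_root E v \<noteq> v}" (is "E = ?P")
proof
  show "?P \<subseteq> E" using parent(1) by auto
  have EK: "E \<subseteq> K_edges n" and ac: "\<nexists>vs. is_cycle E vs" using E by (auto simp: forests_def)
  have path: "(v, comp_root E v) \<in> (edge_rel ?P)\<^sup>*" if "v \<in> {1..n}" for v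
    using that
  proof (induction "root_dist E v" arbitrary: v rule: less_induct)
    case less
    show ?case
    proof (cases "comp_root E v = v")
      case False
      have "{v, parent E v} \<in> K_edges n" using parent(1)[OF False] EK by blast
      then have "parent E v \<in> {1..n}" by simp
      then have "(parent E v, comp_root E v) \<in> (edge_rel ?P)\<^sup>*"
        using less(1)[of "parent E v"] parent(2,3)[OF False] by simp
      moreover have "(v, parent E v) \<in> edge_rel ?P" using False less.prems by auto
      ultimately show ?thesis by (meson converse_rtrancl_into_rtrancl)
    qed simp
  qed
  show "E \<subseteq> ?P"
  proof (rule ccontr)
    assume "\<not> E \<subseteq> ?P"
    then obtain e where e: "e \<in> E" "e \<notin> ?P" by blast
    then have "e \<in> K_edges n" using EK by blast
    then obtain x y where xy: "e = {x, y}" "x \<noteq> y" "x \<in> {1..n}" "y \<in> {1..n}"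
      unfolding nsets_2_eq by blast
    have "(x, y) \<in> (edge_rel E)\<^sup>*" using e xy by auto
    then have "comp_root E x = comp_root E y" by (rule comp_root_eq)
    then have "(x, y) \<in> (edge_rel ?P)\<^sup>*"
      using path[OF xy(3)] edge_rel_rtrancl_sym[OF path[OF xy(4)]] by (simp add: rtrancl_trans)
    moreover have "?P \<subseteq> E - {{x, y}}" using e(2) xy(1) \<open>?P \<subseteq> E\<close> by blast
    then have "edge_rel ?P \<subseteq> edge_rel (E - {{x, y}})" by blast
    ultimately have "(x, y) \<in> (edge_rel (E - {{x, y}}))\<^sup>*" using rtrancl_mono by blast
    then show False using acyclic_edge_separates[OF ac, of x y] e xy by simp
  qed
qed

text \<open>Edges are counted by the non-roots whose parent edges they are, components by their
  roots.\<close>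

lemma card_forest:
  assumes E: "E \<in> forests n"
  shows "card E + card {v\<in>{1..n}. comp_root E v = v} = n"
proof -
  have "card E = card {v\<in>{1..n}. comp_root E v \<noteq> v}"
    by (subst forest_eq_parent_edges[OF E], rule card_image) (rule inj_on_subset[OF parent_edge_inj], auto)
  moreover have "card {v\<in>{1..n}. comp_root E v \<noteq> v} + card {v\<in>{1..n}. comp_root E v = v} = card {1..n}"
  proof (subst card_Un_disjoint[symmetric])
    show "card ({v\<in>{1..n}. comp_root E v \<noteq> v} \<union> {v\<in>{1..n}. comp_root E v = v}) = card {1..n}"
      by (rule arg_cong[where f=card]) blast
  qed auto
  ultimately show ?thesis by simp
qed

lemma finite_forests: "finite (forests n)"
  by (rule finite_subset[of _ "Pow (K_edges n)"]) (auto simp: forests_def intro: finite_imp_finite_nsets)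

lemma forest_subset: "E \<in> forests n \<Longrightarrow> B \<subseteq> E \<Longrightarrow> B \<in> forests n"
  by (auto simp: forests_def is_cycle_def) blast

lemma forest_finite: "E \<in> forests n \<Longrightarrow> finite E"
  by (auto simp: forests_def intro: finite_subset finite_imp_finite_nsets)

lemma tree_comp_root:
  assumes "E \<in> spanning_trees n" "v \<in> {1..n}"
  shows "comp_root E v = 1"
proof -
  have E: "E \<subseteq> K_edges n" "(v, 1) \<in> (edge_rel E)\<^sup>*"
    using assms by (auto simp: spanning_trees_def forests_def connects_def)
  show ?thesis using comp_root_le[OF E(2)] comp_root_in[OF E(1) assms(2)] by simp
qed

lemma card_spanning_tree:
  assumes "E \<in> spanning_trees n" "n \<ge> 1"
  shows "card E = n - 1"
proof -
  have "E \<in> forests n" using assms by (simp add: spanning_trees_def)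
  moreover have "{v\<in>{1..n}. comp_root E v = v} = {1}" using tree_comp_root[OF assms(1)] assms(2) by auto
  ultimately show ?thesis using card_forest[of E n] by simp
qed

section \<open>Component sizes and the number of trees containing a forest\<close>

definition comp_class :: "nat set set \<Rightarrow> nat \<Rightarrow> nat \<Rightarrow> nat set" where
  "comp_class B n \<rho> = {v\<in>{1..n}. comp_root B v = \<rho>}"

lemma finite_c_max_set:
  "finite {prod_list xs | xs :: nat list. length xs = n - t \<and> (\<forall>x \<in> set xs. x > 0) \<and> sum_list xs = n}"
proof (rule finite_subset)
  show "{prod_list xs | xs :: nat list. length xs = n - t \<and> (\<forall>x \<in> set xs. x > 0) \<and> sum_list xs = n}
    \<subseteq> prod_list ` {xs. set xs \<subseteq> {..n} \<and> length xs = n - t}"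
  proof
    fix z assume "z \<in> {prod_list xs | xs :: nat list. length xs = n - t \<and> (\<forall>x \<in> set xs. x > 0) \<and> sum_list xs = n}"
    then obtain xs where xs: "z = prod_list xs" "length xs = n - t" "sum_list xs = n" by blast
    have "set xs \<subseteq> {..n}" using member_le_sum_list[of _ xs] xs(3) by auto
    then show "z \<in> prod_list ` {xs. set xs \<subseteq> {..n} \<and> length xs = n - t}" using xs by blast
  qed
  show "finite (prod_list ` {xs. set xs \<subseteq> {..n} \<and> length xs = n - t})"
    by (intro finite_imageI finite_lists_length_eq) simp
qed

lemma prod_list_le_c_max:
  assumes "length xs = n - t" "\<forall>x \<in> set xs. x > 0" "sum_list xs = n"
  shows "prod_list xs \<le> c_max n t"
  unfolding c_max_def by (rule Max_ge[OF finite_c_max_set]) (use assms in blast)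

text \<open>A forest has n - |B| components, so their sizes form one of the lists over which
  \<open>c_max n (card B)\<close> is maximised.\<close>

lemma prod_comp_class_le_c_max:
  assumes B: "B \<in> forests n"
  shows "(\<Prod>\<rho>\<in>{v\<in>{1..n}. comp_root B v = v}. card (comp_class B n \<rho>)) \<le> c_max n (card B)"
proof -
  let ?R = "{v\<in>{1..n}. comp_root B v = v}"
  have BK: "B \<subseteq> K_edges n" using B by (auto simp: forests_def)
  have fR: "finite ?R" by simp
  let ?xs = "map (\<lambda>\<rho>. card (comp_class B n \<rho>)) (sorted_list_of_set ?R)"
  have "length ?xs = n - card B" using card_forest[OF B] by simp
  moreover have "\<forall>x\<in>set ?xs. x > 0"
    by (auto simp: card_gt_0_iff comp_class_def)
  moreover have "sum_list ?xs = n"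
  proof -
    have "sum_list ?xs = (\<Sum>\<rho>\<in>?R. card (comp_class B n \<rho>))"
      using fR by (simp add: sum_list_distinct_conv_sum_set)
    also have "\<dots> = card (\<Union>\<rho>\<in>?R. comp_class B n \<rho>)"
      by (rule card_UN_disjoint[symmetric]) (auto simp: comp_class_def)
    also have "(\<Union>\<rho>\<in>?R. comp_class B n \<rho>) = {1..n}"
      using comp_root_in[OF BK] comp_root_idem by (auto simp: comp_class_def)
    finally show ?thesis by simp
  qed
  ultimately have "prod_list ?xs \<le> c_max n (card B)" by (rule prod_list_le_c_max)
  moreover have "prod_list ?xs = (\<Prod>\<rho>\<in>?R. card (comp_class B n \<rho>))"
    using prod.distinct_set_conv_list[of "sorted_list_of_set ?R" "\<lambda>\<rho>. card (comp_class B n \<rho>)"] fR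
    by (simp only: distinct_sorted_list_of_set set_sorted_list_of_set)
  ultimately show ?thesis by simp
qed

text \<open>Root the trees at vertex 1. In a tree \<open>E \<supseteq> B\<close> the vertex closest to 1 of each component of \<open>B\<close>
  not containing 1 has its parent edge outside \<open>B\<close>, and \<open>E\<close> consists of \<open>B\<close> and these edges.\<close>

lemma card_trees_containing_forest:
  assumes B: "B \<in> forests n" and n: "n \<ge> 1"
  shows "card (fam_star (spanning_trees n) B) \<le> n ^ (n - card B - 1) * c_max n (card B)"
proof -
  let ?R = "{v\<in>{1..n}. comp_root B v = v}"
  have BK: "B \<subseteq> K_edges n" using B by (auto simp: forests_def)
  have "comp_root B 1 = 1"
    using comp_root_in[OF BK, of 1] comp_root_le[of 1 1 B] n by simp
  then have one: "1 \<in> ?R" using n by simp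
  have cR: "card B + card ?R = n" by (rule card_forest[OF B])
  \<comment> \<open>The code of a tree: for each component of \<open>B\<close> without 1, its vertex
    closest to 1 and the parent of that vertex, with |component| * n choices.\<close>
  let ?D = "PiE (?R - {1}) (\<lambda>\<rho>. comp_class B n \<rho> \<times> {1..n})"
  have ex: "\<exists>g\<in>?D. E = B \<union> (\<lambda>\<rho>. {fst (g \<rho>), snd (g \<rho>)}) ` (?R - {1})"
    if E: "E \<in> fam_star (spanning_trees n) B" for E
  proof -
    have Et: "E \<in> spanning_trees n" and BE: "B \<subseteq> E" using E by (auto simp: fam_star_def)
    have Ef: "E \<in> forests n" and EK: "E \<subseteq> K_edges n" using Et by (auto simp: spanning_trees_def forests_def)
    have "\<exists>v. v \<in> comp_class B n \<rho> \<and> v \<noteq> 1 \<and> {v, parent E v} \<notin> B" if \<rho>: "\<rho> \<in> ?R - {1}" for \<rho>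
    proof -
      have \<rho>in: "\<rho> \<in> comp_class B n \<rho>" using \<rho> by (auto simp: comp_class_def)
      obtain v where v: "v \<in> comp_class B n \<rho>"
        and vmin: "\<And>w. w \<in> comp_class B n \<rho> \<Longrightarrow> root_dist E v \<le> root_dist E w"
        using ex_has_least_nat[of "\<lambda>v. v \<in> comp_class B n \<rho>" \<rho> "root_dist E"] \<rho>in by auto
      have "v \<noteq> 1" using v \<rho> \<open>comp_root B 1 = 1\<close> by (auto simp: comp_class_def)
      then have "comp_root E v \<noteq> v" using tree_comp_root[OF Et, of v] v by (auto simp: comp_class_def)
      note par = parent[OF this]
      \<comment> \<open>Otherwise the parent would be a vertex of the same component of
        \<open>B\<close> closer to 1 than \<open>v\<close>.\<close>
      have "{v, parent E v} \<notin> B"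
      proof
        assume vB: "{v, parent E v} \<in> B"
        then have "comp_root B v = comp_root B (parent E v)" by (intro comp_root_eq) auto
        moreover have "{v, parent E v} \<in> K_edges n" using vB BK by blast
        then have "parent E v \<in> {1..n}" by simp
        ultimately have "parent E v \<in> comp_class B n \<rho>" using v by (auto simp: comp_class_def)
        then show False using vmin[of "parent E v"] par(2) by simp
      qed
      then show ?thesis using v \<open>v \<noteq> 1\<close> by blast
    qed
    then obtain top where top: "\<And>\<rho>. \<rho> \<in> ?R - {1} \<Longrightarrow> top \<rho> \<in> comp_class B n \<rho> \<and> top \<rho> \<noteq> 1 \<and> {top \<rho>, parent E (top \<rho>)} \<notin> B"
      by metis
    define g where "g = (\<lambda>\<rho>\<in>?R - {1}. (top \<rho>, parent E (top \<rho>)))"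
    have nonroot: "comp_root E (top \<rho>) \<noteq> top \<rho>" "top \<rho> \<in> {1..n}" if "\<rho> \<in> ?R - {1}" for \<rho>
      using top[OF that] tree_comp_root[OF Et, of "top \<rho>"] by (auto simp: comp_class_def)
    have edge: "{top \<rho>, parent E (top \<rho>)} \<in> E" if "\<rho> \<in> ?R - {1}" for \<rho>
      using parent(1)[OF nonroot(1)[OF that]] .
    have "parent E (top \<rho>) \<in> {1..n}" if "\<rho> \<in> ?R - {1}" for \<rho>
    proof -
      have "{top \<rho>, parent E (top \<rho>)} \<in> K_edges n" using edge[OF that] EK by blast
      then show ?thesis by simp
    qed
    then have gD: "g \<in> ?D" using top by (auto simp: g_def)
    let ?h = "\<lambda>\<rho>. {fst (g \<rho>), snd (g \<rho>)}"
    have h: "?h \<rho> = {top \<rho>, parent E (top \<rho>)}" if "\<rho> \<in> ?R - {1}" for \<rho>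
      using that by (simp add: g_def)
    have inj: "inj_on ?h (?R - {1})"
    proof (rule inj_onI)
      fix \<rho> \<sigma> assume rs: "\<rho> \<in> ?R - {1}" "\<sigma> \<in> ?R - {1}" and eq: "?h \<rho> = ?h \<sigma>"
      have "top \<rho> = top \<sigma>"
        using inj_onD[OF parent_edge_inj[of E], of "top \<rho>" "top \<sigma>"] eq nonroot rs h by simp
      then show "\<rho> = \<sigma>" using top[OF rs(1)] top[OF rs(2)] by (simp add: comp_class_def)
    qed
    \<comment> \<open>Inclusion is clear and the sizes agree: |B| plus the number of components
      minus one is n - 1.\<close>
    have "B \<union> ?h ` (?R - {1}) = E"
    proof (rule card_subset_eq)
      show "finite E" by (rule forest_finite[OF Ef])
      show "B \<union> ?h ` (?R - {1}) \<subseteq> E" using BE edge h by auto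
      have "card (B \<union> ?h ` (?R - {1})) = card B + card (?h ` (?R - {1}))"
      proof (rule card_Un_disjoint)
        show "finite B" by (rule forest_finite[OF B])
        show "B \<inter> ?h ` (?R - {1}) = {}" using top h by auto
      qed simp
      also have "\<dots> = card B + (card ?R - 1)" using inj one by (simp add: card_image)
      also have "\<dots> = n - 1"
      proof -
        have "card ?R > 0" using one by (auto simp: card_gt_0_iff)
        then show ?thesis using cR by simp
      qed
      finally show "card (B \<union> ?h ` (?R - {1})) = card E" using card_spanning_tree[OF Et n] by simp
    qed
    then show ?thesis using gD by blast
  qed
  have finD: "finite ?D" by (intro finite_PiE) (auto simp: comp_class_def)
  have "fam_star (spanning_trees n) B \<subseteq> (\<lambda>g. B \<union> (\<lambda>\<rho>. {fst (g \<rho>), snd (g \<rho>)}) ` (?R - {1})) ` ?D"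
    using ex by blast
  then have "card (fam_star (spanning_trees n) B) \<le> card ?D"
    by (rule surj_card_le[OF finD])
  also have "\<dots> = (\<Prod>\<rho>\<in>?R - {1}. card (comp_class B n \<rho>) * n)"
    by (simp add: card_PiE card_cartesian_product)
  also have "\<dots> = (\<Prod>\<rho>\<in>?R - {1}. card (comp_class B n \<rho>)) * n ^ (n - card B - 1)"
  proof -
    have "card (?R - {1}) = n - card B - 1" using cR card_Diff_singleton[OF one] by linarith
    then show ?thesis by (simp only: prod.distrib prod_constant)
  qed
  also have "(\<Prod>\<rho>\<in>?R - {1}. card (comp_class B n \<rho>)) \<le> (\<Prod>\<rho>\<in>?R. card (comp_class B n \<rho>))"
  proof -
    have "(\<Prod>\<rho>\<in>?R. card (comp_class B n \<rho>)) = card (comp_class B n 1) * (\<Prod>\<rho>\<in>?R - {1}. card (comp_class B n \<rho>))"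
      by (rule prod.remove) (use one in auto)
    moreover have "card (comp_class B n 1) > 0" using one by (auto simp: card_gt_0_iff comp_class_def)
    ultimately show ?thesis by simp
  qed
  also note prod_comp_class_le_c_max[OF B]
  finally show ?thesis by (simp add: mult.commute)
qed

text \<open>An optimal list for \<open>Suc s\<close> has fewer than \<open>n\<close> parts, so some
  part x is at least 2. Splitting it into 1 and x - 1 gives a list for \<open>s\<close>, and x \<le>
  2 (x - 1).\<close>

lemma c_max_Suc_le:
  assumes "Suc s < n"
  shows "c_max n (Suc s) \<le> 2 * c_max n s"
proof -
  let ?P = "{prod_list xs | xs :: nat list. length xs = n - Suc s \<and> (\<forall>x \<in> set xs. x > 0) \<and> sum_list xs = n}"
  have "Suc s + (n - Suc s - 1) + 1 = n" using assms by simp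
  \<comment> \<open>The maximum is attained only if the set is nonempty; one part s + 2 and
    otherwise ones is an admissible list.\<close>
  then have "prod_list (Suc (Suc s) # replicate (n - Suc s - 1) 1) \<in> ?P"
    using assms by (intro CollectI exI[of _ "Suc (Suc s) # replicate (n - Suc s - 1) 1"]) (auto simp: sum_list_replicate)
  then have "?P \<noteq> {}" by blast
  then have "c_max n (Suc s) \<in> ?P" unfolding c_max_def by (rule Max_in[OF finite_c_max_set])
  then obtain xs where xs: "c_max n (Suc s) = prod_list xs" "length xs = n - Suc s"
    "\<forall>x \<in> set xs. x > 0" "sum_list xs = n" by auto
  have "\<exists>x\<in>set xs. x \<ge> 2"
  proof (rule ccontr)
    assume "\<not> ?thesis"
    then have "\<forall>x\<in>set xs. x = 1" using xs(3) by force
    then have "map (\<lambda>x. x) xs = map (\<lambda>_. 1) xs" by (intro map_cong) auto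
    then have "sum_list xs = length xs" using sum_list_triv[of "1::nat" xs] by simp
    then show False using xs assms by simp
  qed
  then obtain x where x: "x \<in> set xs" "x \<ge> 2" by blast
  then obtain ys zs where s: "xs = ys @ x # zs" by (meson split_list)
  let ?ws = "ys @ 1 # (x - 1) # zs"
  have "prod_list ?ws \<le> c_max n s"
    by (rule prod_list_le_c_max) (use xs x assms s in auto)
  moreover have "prod_list xs \<le> 2 * prod_list ?ws"
  proof -
    have "prod_list xs = (prod_list ys * prod_list zs) * x" by (simp add: s)
    also have "\<dots> \<le> (prod_list ys * prod_list zs) * (2 * (x - 1))" using x by (intro mult_left_mono) auto
    finally show ?thesis by (simp add: mult_ac)
  qed
  ultimately show ?thesis using xs(1) by linarith
qed

lemma c_max_add_le: "s + b < n \<Longrightarrow> c_max n (s + b) \<le> 2 ^ b * c_max n s"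
proof (induction b)
  case (Suc b)
  have "c_max n (s + Suc b) \<le> 2 * c_max n (s + b)" using c_max_Suc_le[of "s + b" n] Suc.prems by simp
  also have "\<dots> \<le> 2 * (2 ^ b * c_max n s)" using Suc by (intro mult_left_mono) auto
  finally show ?case by simp
qed simp

section \<open>Intersecting families of trees\<close>

lemma spanning_tree_forest: "E \<in> spanning_trees n \<Longrightarrow> E \<in> forests n"
  by (simp add: spanning_trees_def)

lemma finite_spanning_trees: "finite (spanning_trees n)"
  by (rule finite_subset[OF _ finite_forests[of n]]) (auto simp: spanning_trees_def)

lemma finite_K_edges: "finite (K_edges n)"
  by (simp add: finite_imp_finite_nsets)

lemma card_forest_less:
  assumes B: "B \<in> forests n" and n: "n \<ge> 1"
  shows "card B < n"
proof -
  have "B \<subseteq> K_edges n" using B by (simp add: forests_def)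
  then have "comp_root B 1 \<in> {v\<in>{1..n}. comp_root B v = v}"
    using comp_root_in[of B n 1] n comp_root_idem by simp
  then have "card {v\<in>{1..n}. comp_root B v = v} > 0" by (auto simp: card_gt_0_iff)
  then show ?thesis using card_forest[OF B] by linarith
qed

text \<open>For b = |B| - t, the weight contributes r^b, the exponent of n drops by b, and
  \<open>c_max\<close> grows by at most 2^b, together (2r/n)^b; as 2r \<le> n, b may be lowered to
  \<open>m\<close>. The extra factor n comes from comparing the exponent n - |B| - 1 with n - 2 -
  t.\<close>

lemma tree_weight_bound:
  fixes r :: real
  assumes B: "B \<in> forests n" and cB: "t + m \<le> card B" and n: "t + 2 \<le> n"
    and r: "0 < r" "2 * r \<le> real n" and u: "u \<le> t"
  shows "r ^ (card B - u) * real (card (fam_star (spanning_trees n) B))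
    \<le> real n * r ^ (t - u) * (2 * r / real n) ^ m * (real (c_max n t) * real n ^ (n - 2 - t))"
proof -
  have n1: "n \<ge> 1" using n by simp
  have cn: "card B < n" by (rule card_forest_less[OF B n1])
  define b where "b = card B - t"
  have b: "card B = t + b" "m \<le> b" using cB by (auto simp: b_def)
  have "card (fam_star (spanning_trees n) B) \<le> n ^ (n - card B - 1) * c_max n (card B)"
    by (rule card_trees_containing_forest[OF B n1])
  also have "\<dots> \<le> n ^ (n - card B - 1) * (2 ^ b * c_max n t)"
    using c_max_add_le[of t b n] cn b by (intro mult_left_mono) auto
  finally have "real (card (fam_star (spanning_trees n) B)) \<le> real (n ^ (n - card B - 1) * (2 ^ b * c_max n t))"
    by (rule of_nat_mono)
  also have "\<dots> = real n ^ (n - card B - 1) * (2 ^ b * real (c_max n t))" by simp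
  also have "real n ^ (n - card B - 1) = real n * real n ^ (n - 2 - t) / real n ^ b"
  proof -
    have "(n - card B - 1) + b = Suc (n - 2 - t)" using cn b n by linarith
    then have "real n ^ (n - card B - 1) * real n ^ b = real n * real n ^ (n - 2 - t)"
      by (metis power_Suc power_add)
    then show ?thesis using n1 by (simp add: field_simps)
  qed
  finally have star: "real (card (fam_star (spanning_trees n) B))
     \<le> real n * real n ^ (n - 2 - t) / real n ^ b * (2 ^ b * real (c_max n t))" .
  have rb: "r ^ (card B - u) = r ^ (t - u) * r ^ b"
    using b u by (simp add: power_add[symmetric])
  have "r ^ (card B - u) * real (card (fam_star (spanning_trees n) B))
    \<le> r ^ (card B - u) * (real n * real n ^ (n - 2 - t) / real n ^ b * (2 ^ b * real (c_max n t)))"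
    using star r by (intro mult_left_mono) auto
  also have "\<dots> = real n * r ^ (t - u) * (2 * r / real n) ^ b * (real (c_max n t) * real n ^ (n - 2 - t))"
    unfolding rb by (simp add: power_divide power_mult_distrib)
  also have "\<dots> \<le> real n * r ^ (t - u) * (2 * r / real n) ^ m * (real (c_max n t) * real n ^ (n - 2 - t))"
    using r b n1 by (intro mult_right_mono mult_left_mono power_decreasing) auto
  finally show ?thesis .
qed

text \<open>Every member of \<open>F - F0\<close> contains a \<open>u\<close>-subset of one fixed member of \<open>S0\<close>, so that
  the spread approximation only has to be run inside the stars of these \<open>u\<close>-sets.\<close>

lemma spread_refinement:
  fixes r X :: real
  assumes F: "F \<subseteq> spanning_trees n" "F0 \<subseteq> F" and cover: "\<And>A. A \<in> F - F0 \<Longrightarrow> \<exists>B\<in>S0. B \<subseteq> A"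
    and S0: "\<And>B. B \<in> S0 \<Longrightarrow> finite B \<and> card B \<le> w" "\<And>B B'. B \<in> S0 \<Longrightarrow> B' \<in> S0 \<Longrightarrow> u \<le> card (B \<inter> B')"
    and r: "r > 1" and X: "X \<ge> 0"
    and bnd: "\<And>B. B \<in> forests n \<Longrightarrow> w' < card B \<Longrightarrow>
      r ^ (card B - u) * real (card (fam_star (spanning_trees n) B)) \<le> X"
  shows "\<exists>S F1. F1 \<subseteq> F \<and> (\<forall>A\<in>F - F1. \<exists>B\<in>S. B \<subseteq> A) \<and>
    (\<forall>B\<in>S. B \<in> forests n \<and> card B \<le> w' \<and> (\<exists>H\<subseteq>F. star_spread r B H)) \<and>
    real (card F1) \<le> real (card F0) + real (w choose u) * X"
proof (cases "F - F0 = {}")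
  case True
  then have "F0 = F" using F by auto
  then show ?thesis using X by (intro exI[of _ "{}"] exI[of _ F]) auto
next
  case False
  then obtain B0 where B0: "B0 \<in> S0" using cover by blast
  have fF: "finite F" using F finite_spanning_trees finite_subset by blast
  define TT where "TT = {T. T \<subseteq> B0 \<and> card T = u}"
  have fTT: "finite TT" using S0(1)[OF B0] by (auto simp: TT_def)
  have cTT: "card TT \<le> w choose u"
    using S0(1)[OF B0] unfolding TT_def by (simp add: n_subsets binomial_right_mono)
  define G where "G T = fam_star (F - F0) T" for T
  have GF: "G T \<subseteq> F" for T by (auto simp: G_def fam_star_def)
  have GA: "finite A \<and> T \<subseteq> A" if "A \<in> G T" for A T
  proof -
    have "A \<in> spanning_trees n" using that GF F(1) by blast
    then show ?thesis using forest_finite[OF spanning_tree_forest] that by (auto simp: G_def fam_star_def)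
  qed
  have "\<exists>S R. R \<subseteq> G T \<and> (\<forall>A\<in>G T - R. \<exists>B\<in>S. B \<subseteq> A) \<and>
     (\<forall>B\<in>S. T \<subseteq> B \<and> card B \<le> w' \<and> (\<exists>H\<subseteq>G T. star_spread r B H)) \<and>
     (R = {} \<or> (\<exists>B. T \<subseteq> B \<and> w' < card B \<and> fam_star (G T) B \<noteq> {} \<and>
        real (card R) \<le> r ^ (card B - card T) * real (card (fam_star (G T) B))))" for T
    using finite_subset[OF GF fF] GA r by (rule spread_approximation)
  then obtain S R where SR: "\<And>T. R T \<subseteq> G T" "\<And>T. \<forall>A\<in>G T - R T. \<exists>B\<in>S T. B \<subseteq> A"
     "\<And>T. \<forall>B\<in>S T. T \<subseteq> B \<and> card B \<le> w' \<and> (\<exists>H\<subseteq>G T. star_spread r B H)"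
     "\<And>T. R T = {} \<or> (\<exists>B. T \<subseteq> B \<and> w' < card B \<and> fam_star (G T) B \<noteq> {} \<and>
        real (card (R T)) \<le> r ^ (card B - card T) * real (card (fam_star (G T) B)))"
    by metis
  \<comment> \<open>A stuck \<open>B\<close> lies in a tree of \<open>F\<close>, so it is a forest
    with more than \<open>w'\<close> edges, and \<open>bnd\<close> applies.\<close>
  have RX: "real (card (R T)) \<le> X" if T: "T \<in> TT" for T
  proof (cases "R T = {}")
    case False
    then obtain B where B: "T \<subseteq> B" "w' < card B" "fam_star (G T) B \<noteq> {}"
      "real (card (R T)) \<le> r ^ (card B - card T) * real (card (fam_star (G T) B))"
      using SR(4)[of T] by blast
    obtain A where "A \<in> F" "B \<subseteq> A" using B(3) GF by (auto simp: fam_star_def)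
    then have Bf: "B \<in> forests n" using F(1) forest_subset spanning_tree_forest by blast
    have "fam_star (G T) B \<subseteq> fam_star (spanning_trees n) B" using GF F(1) by (auto simp: fam_star_def)
    then have "card (fam_star (G T) B) \<le> card (fam_star (spanning_trees n) B)"
      by (intro card_mono) (auto simp: fam_star_def finite_spanning_trees)
    then have "r ^ (card B - u) * real (card (fam_star (G T) B))
      \<le> r ^ (card B - u) * real (card (fam_star (spanning_trees n) B))"
      using r by (intro mult_left_mono) auto
    then show ?thesis using B(4) bnd[OF Bf B(2)] T by (simp add: TT_def)
  qed (use X in simp)
  define F1 where "F1 = F0 \<union> (\<Union>T\<in>TT. R T)"
  define SS where "SS = (\<Union>T\<in>TT. S T)"
  have "F1 \<subseteq> F" using F(2) SR(1) GF unfolding F1_def by blast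
  moreover have "\<forall>A\<in>F - F1. \<exists>B\<in>SS. B \<subseteq> A"
  proof
    fix A assume A: "A \<in> F - F1"
    then have A0: "A \<in> F - F0" by (auto simp: F1_def)
    then obtain B where B: "B \<in> S0" "B \<subseteq> A" using cover by blast
    \<comment> \<open>The member of \<open>S0\<close> below \<open>A\<close> shares at least
      \<open>u\<close> elements with the fixed \<open>B0\<close>, so \<open>A\<close> lies in one of
      the chosen stars.\<close>
    obtain T where T: "T \<subseteq> B \<inter> B0" "card T = u"
      using S0(2)[OF B(1) B0] obtain_subset_with_card_n by blast
    have "T \<in> TT" "A \<in> G T" using T B A0 by (auto simp: TT_def G_def fam_star_def)
    moreover have "A \<notin> R T" using A \<open>T \<in> TT\<close> by (auto simp: F1_def)
    ultimately show "\<exists>B\<in>SS. B \<subseteq> A" using SR(2)[of T] unfolding SS_def by blast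
  qed
  moreover have "\<forall>B\<in>SS. B \<in> forests n \<and> card B \<le> w' \<and> (\<exists>H\<subseteq>F. star_spread r B H)"
  proof
    fix B assume "B \<in> SS"
    then obtain T where T: "T \<in> TT" "B \<in> S T" by (auto simp: SS_def)
    then obtain H where H: "H \<subseteq> G T" "star_spread r B H" "card B \<le> w'" using SR(3) by blast
    have HF: "H \<subseteq> F" using H(1) GF by blast
    obtain A where "A \<in> H" "B \<subseteq> A" using H(2) by (auto simp: star_spread_def)
    then have "B \<in> forests n" using HF F(1) forest_subset spanning_tree_forest by blast
    then show "B \<in> forests n \<and> card B \<le> w' \<and> (\<exists>H\<subseteq>F. star_spread r B H)" using H HF by blast
  qed
  moreover have "real (card F1) \<le> real (card F0) + real (w choose u) * X"
  proof -
    have "card F1 \<le> card F0 + card (\<Union>T\<in>TT. R T)" unfolding F1_def by (rule card_Un_le)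
    also have "card (\<Union>T\<in>TT. R T) \<le> (\<Sum>T\<in>TT. card (R T))" by (rule card_UN_le[OF fTT])
    finally have "card F1 \<le> card F0 + (\<Sum>T\<in>TT. card (R T))" by simp
    then have "real (card F1) \<le> real (card F0 + (\<Sum>T\<in>TT. card (R T)))" by (rule of_nat_mono)
    then have "real (card F1) \<le> real (card F0) + (\<Sum>T\<in>TT. real (card (R T)))" by simp
    also have "(\<Sum>T\<in>TT. real (card (R T))) \<le> (\<Sum>T\<in>TT. X)" using RX by (rule sum_mono)
    also have "\<dots> = real (card TT) * X" by simp
    also have "\<dots> \<le> real (w choose u) * X" using cTT X by (intro mult_right_mono) auto
    finally show ?thesis by simp
  qed
  ultimately have "F1 \<subseteq> F \<and> (\<forall>A\<in>F - F1. \<exists>B\<in>SS. B \<subseteq> A) \<and>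
    (\<forall>B\<in>SS. B \<in> forests n \<and> card B \<le> w' \<and> (\<exists>H\<subseteq>F. star_spread r B H)) \<and>
    real (card F1) \<le> real (card F0) + real (w choose u) * X"
    by (intro conjI)
  then show ?thesis by (intro exI)
qed

section \<open>Intersections of centres of spread families of trees\<close>

lemma card_tree_le: "A \<in> spanning_trees n \<Longrightarrow> n \<ge> 1 \<Longrightarrow> card A \<le> n"
  by (simp add: card_spanning_tree)

lemma spread_centers_almost_intersecting:
  assumes F: "F \<subseteq> spanning_trees n" "t_intersecting t F" and n: "n \<ge> 1" and r: "r > 0"
    and H1: "H1 \<subseteq> F" "star_spread r B1 H1" and H2: "H2 \<subseteq> F" "star_spread r B2 H2"
  shows "real t \<le> real (card (B1 \<inter> B2)) + 2 * real n / r"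
proof -
  have "card A \<le> n" if "A \<in> H1 \<union> H2" for A
    using that H1(1) H2(1) F(1) card_tree_le[OF _ n] by blast
  then obtain A1 A2 where A: "A1 \<in> H1" "A2 \<in> H2" "real (card (A1 \<inter> A2)) \<le> real (card (B1 \<inter> B2)) + 2 * real n / r"
    using star_spread_small_pair[OF H1(2) H2(2) r, of n] by blast
  have "t \<le> card (A1 \<inter> A2)" using F(2) A(1,2) H1(1) H2(1) unfolding t_intersecting_def by blast
  then show ?thesis using A(3) by linarith
qed

lemma star_spread_finite_center: "star_spread r B H \<Longrightarrow> finite B"
  unfolding star_spread_def by (meson all_not_in_conv finite_subset)

text \<open>Keeping half of the family costs a factor 2, absorbed by \<open>2 ^ card Y\<close> for
  nonempty \<open>Y\<close>: the spread drops from r to r/2. This is where \<rho> = 2/r in the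
  disjoint pair comes from.\<close>

lemma star_spread_restrict:
  fixes r :: real
  assumes H: "star_spread r B H" and r: "r > 0" and I: "I \<subseteq> H" "real (card H) \<le> 2 * real (card I)" and Y: "finite Y"
  shows "real (card {A\<in>I. Y \<subseteq> A - B}) \<le> real (card I) * (2 / r) ^ card Y"
proof -
  consider "Y = {}" | "Y \<noteq> {}" "Y \<inter> B \<noteq> {}" | "Y \<noteq> {}" "Y \<inter> B = {}" by blast
  then show ?thesis
  proof cases
    case 1
    then show ?thesis by simp
  next
    case 2
    then have "{A\<in>I. Y \<subseteq> A - B} = {}" by blast
    then have "card {A\<in>I. Y \<subseteq> A - B} = 0" by (simp only: card.empty)
    then show ?thesis using r by simp
  next
    case 3
    have "card Y \<noteq> 0" using 3 Y by simp
    then have two: "(2::real) \<le> 2 ^ card Y" using power_increasing[of 1 "card Y" "2::real"] by simp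
    have rY: "r ^ card Y > 0" using r by simp
    have "{A\<in>I. Y \<subseteq> A - B} \<subseteq> fam_star H Y" using I(1) by (auto simp: fam_star_def)
    then have "card {A\<in>I. Y \<subseteq> A - B} \<le> card (fam_star H Y)"
      using H by (intro card_mono) (auto simp: fam_star_def star_spread_def)
    then have "r ^ card Y * real (card {A\<in>I. Y \<subseteq> A - B}) \<le> r ^ card Y * real (card (fam_star H Y))"
      using rY by simp
    also have "\<dots> \<le> real (card H)" using H 3 Y by (auto simp: star_spread_def less_imp_le)
    also have "\<dots> \<le> 2 * real (card I)" by (rule I(2))
    also have "\<dots> \<le> 2 ^ card Y * real (card I)" using two by (intro mult_right_mono) auto
    finally show ?thesis using rY by (simp add: power_divide field_simps)
  qed
qed

lemma spread_centers_intersecting: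
  fixes r m :: real
  assumes F: "F \<subseteq> spanning_trees n" "t_intersecting t F" and n: "n \<ge> 1" and r: "r > 0"
    and H1: "H1 \<subseteq> F" "star_spread r B1 H1" and H2: "H2 \<subseteq> F" "star_spread r B2 H2"
    and c: "real (card B1) \<le> real t + m" "real (card B2) \<le> real t + m"
    and m: "m + 2 * real n / r \<le> r / 2"
    and h: "20 * (1 + 12 / r) ^ n \<le> 2 ^ h" "(1 + 16 / r) ^ h \<le> 11 / 10"
  shows "t \<le> card (B1 \<inter> B2)"
proof -
  have tree: "A \<in> spanning_trees n" if "A \<in> H1 \<union> H2" for A using that H1(1) H2(1) F(1) by blast
  have almost: "real t \<le> real (card (B1 \<inter> B2)) + 2 * real n / r"
    by (rule spread_centers_almost_intersecting[OF F n r H1 H2])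
  have fB: "finite B1" "finite B2"
    using star_spread_finite_center H1(2) H2(2) by blast+
  define I where "I = {A\<in>H1. (A - B1) \<inter> (B2 - B1) = {}}"
  define J where "J = {A\<in>H2. (A - B2) \<inter> (B1 - B2) = {}}"
  \<comment> \<open>Each centre has at most t + m edges and they share at least t - 2n/r, so each
    difference has at most m + 2n/r \<le> r/2 edges.\<close>
  have "card (B2 - B1) + card (B1 \<inter> B2) = card B2" "card (B1 - B2) + card (B1 \<inter> B2) = card B1"
    using fB by (metis Int_commute add.commute card_Int_Diff)+
  then have small: "real (card (B2 - B1)) \<le> r / 2" "real (card (B1 - B2)) \<le> r / 2"
    using c m almost by linarith+
  have cI: "real (card H1) \<le> 2 * real (card I)" "real (card H2) \<le> 2 * real (card J)"
    unfolding I_def J_def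
    using star_spread_count_avoiding[OF H1(2) r _ small(1)] star_spread_count_avoiding[OF H2(2) r _ small(2)] fB
    by simp_all
  have pos: "card H1 > 0" "card H2 > 0" "finite H1" "finite H2"
    using H1(2) H2(2) by (auto simp: star_spread_def card_gt_0_iff)
  then have ne: "I \<noteq> {}" "J \<noteq> {}" using cI by auto
  have sub: "I \<subseteq> H1" "J \<subseteq> H2" by (auto simp: I_def J_def)
  have UX: "A - B \<subseteq> K_edges n \<and> card (A - B) \<le> n" if "A \<in> H1 \<union> H2" for A B
  proof -
    have "A \<in> forests n" by (rule spanning_tree_forest[OF tree[OF that]])
    then have "A \<subseteq> K_edges n" "finite A" using forest_finite by (auto simp: forests_def)
    moreover have "card (A - B) \<le> card A" using \<open>finite A\<close> by (intro card_mono) auto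
    ultimately show ?thesis using card_tree_le[OF tree[OF that] n] by auto
  qed
  have "\<exists>A1\<in>I. \<exists>A2\<in>J. (A1 - B1) \<inter> (A2 - B2) = {}"
  proof (rule spread_disjoint_pair[where U = "K_edges n" and k = n and \<rho> = "2 / r" and h = h])
    show "real (card {A\<in>I. Y \<subseteq> A - B1}) \<le> real (card I) * (2 / r) ^ card Y" if "Y \<subseteq> K_edges n" for Y
      using star_spread_restrict[OF H1(2) r sub(1) cI(1)] finite_subset[OF that finite_K_edges] .
    show "real (card {A\<in>J. Y \<subseteq> A - B2}) \<le> real (card J) * (2 / r) ^ card Y" if "Y \<subseteq> K_edges n" for Y
      using star_spread_restrict[OF H2(2) r sub(2) cI(2)] finite_subset[OF that finite_K_edges] .
    show "finite I" "finite J" using sub pos finite_subset by blast+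
    show "I \<noteq> {}" "J \<noteq> {}" by (rule ne)+
    show "A - B1 \<subseteq> K_edges n \<and> card (A - B1) \<le> n" if "A \<in> I" for A using UX that sub by blast
    show "A - B2 \<subseteq> K_edges n \<and> card (A - B2) \<le> n" if "A \<in> J" for A using UX that sub by blast
    show "20 * (1 + 6 * (2 / r)) ^ n \<le> 2 ^ h" "(1 + 8 * (2 / r)) ^ h \<le> 11 / 10" using h by simp_all
  qed (use r finite_K_edges in auto)
  then obtain A1 A2 where A: "A1 \<in> I" "A2 \<in> J" "(A1 - B1) \<inter> (A2 - B2) = {}" by blast
  \<comment> \<open>A common edge outside both centres is excluded by disjointness; one in exactly
    one centre is excluded by the definitions of \<open>I\<close> and \<open>J\<close>.\<close>
  have "A1 \<inter> A2 \<subseteq> B1 \<inter> B2" using A unfolding I_def J_def by blast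
  then have "card (A1 \<inter> A2) \<le> card (B1 \<inter> B2)" using fB by (intro card_mono) auto
  moreover have "t \<le> card (A1 \<inter> A2)"
    using F(2) A(1,2) sub H1(1) H2(1) unfolding t_intersecting_def by blast
  ultimately show ?thesis by linarith
qed

text \<open>Downward induction on \<open>M\<close>, with \<open>j\<close> counting the steps; each
  step adds \<delta> to the error. The bound t - a does not deteriorate: at every step it is derived
  afresh from \<open>F\<close> itself, whose subfamilies are spread around the new centres, and a
  \<ge> 2 sqrt n = 2n/r.\<close>

lemma coarse_approximation:
  fixes \<delta> :: real
  assumes F: "F \<subseteq> spanning_trees n" "t_intersecting t F" and n: "t + 2 \<le> n" "n \<ge> 4"
    and a: "2 * sqrt (real n) \<le> real a" and \<delta>: "\<delta> \<ge> 0"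
    and bnd: "\<And>m. M < m \<Longrightarrow> m \<le> n \<Longrightarrow>
      real ((t + m) choose (t - a)) * (real n * sqrt (real n) ^ a * (2 / sqrt (real n)) ^ m) \<le> \<delta>"
    and M: "M + j = n"
  shows "\<exists>S F1. F1 \<subseteq> F \<and> (\<forall>A\<in>F - F1. \<exists>B\<in>S. B \<subseteq> A) \<and> (\<forall>B\<in>S. finite B \<and> card B \<le> t + M) \<and>
    (\<forall>B\<in>S. \<forall>B'\<in>S. t - a \<le> card (B \<inter> B')) \<and>
    real (card F1) \<le> real j * \<delta> * (real (c_max n t) * real n ^ (n - 2 - t))"
  using M bnd
proof (induction j arbitrary: M)
  case 0
  have "finite B \<and> card B \<le> t + M" if "B \<in> F" for B
    using that F(1) card_tree_le[of B n] forest_finite[OF spanning_tree_forest[of B n]] n 0 by fastforce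
  moreover have "t - a \<le> card (B \<inter> B')" if "B \<in> F" "B' \<in> F" for B B'
    using F(2) that unfolding t_intersecting_def by (meson diff_le_self order_trans)
  ultimately show ?case by (intro exI[of _ F] exI[of _ "{}"]) auto
next
  case (Suc j)
  let ?Q = "real (c_max n t) * real n ^ (n - 2 - t)" and ?r = "sqrt (real n)"
  have M1: "Suc M + j = n" using Suc.prems(1) by simp
  obtain S0 F0 where S0: "F0 \<subseteq> F" "\<forall>A\<in>F - F0. \<exists>B\<in>S0. B \<subseteq> A" "\<forall>B\<in>S0. finite B \<and> card B \<le> t + Suc M"
    "\<forall>B\<in>S0. \<forall>B'\<in>S0. t - a \<le> card (B \<inter> B')" "real (card F0) \<le> real j * \<delta> * ?Q"
  proof -
    have "\<exists>S F1. F1 \<subseteq> F \<and> (\<forall>A\<in>F - F1. \<exists>B\<in>S. B \<subseteq> A) \<and> (\<forall>B\<in>S. finite B \<and> card B \<le> t + Suc M) \<and>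
      (\<forall>B\<in>S. \<forall>B'\<in>S. t - a \<le> card (B \<inter> B')) \<and> real (card F1) \<le> real j * \<delta> * ?Q"
      by (rule Suc.IH[OF M1]) (rule Suc.prems(2), simp_all)
    then show thesis using that by blast
  qed
  have r: "?r > 1" using n by (simp add: real_less_rsqrt)
  have rr: "?r * ?r = real n" by simp
  have r2: "2 * ?r \<le> real n"
  proof -
    have "2 \<le> ?r" using n by (intro real_le_rsqrt) auto
    then have "2 * ?r \<le> ?r * ?r" using r by (intro mult_right_mono) auto
    then show ?thesis by simp
  qed
  have two: "2 * ?r / real n = 2 / ?r" using r rr by (simp add: field_simps)
  define X where "X = real n * ?r ^ a * (2 / ?r) ^ Suc M * ?Q"
  have X0: "X \<ge> 0" unfolding X_def by simp
  have Xb: "?r ^ (card B - (t - a)) * real (card (fam_star (spanning_trees n) B)) \<le> X"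
    if "B \<in> forests n" "t + M < card B" for B
  proof -
    have "?r ^ (card B - (t - a)) * real (card (fam_star (spanning_trees n) B))
      \<le> real n * ?r ^ (t - (t - a)) * (2 * ?r / real n) ^ Suc M * ?Q"
      by (rule tree_weight_bound) (use that n r r2 in auto)
    also have "\<dots> \<le> real n * ?r ^ a * (2 * ?r / real n) ^ Suc M * ?Q"
      using r by (intro mult_right_mono mult_left_mono power_increasing) auto
    finally show ?thesis unfolding X_def two .
  qed
  have "\<exists>S F1. F1 \<subseteq> F \<and> (\<forall>A\<in>F - F1. \<exists>B\<in>S. B \<subseteq> A) \<and>
    (\<forall>B\<in>S. B \<in> forests n \<and> card B \<le> t + M \<and> (\<exists>H\<subseteq>F. star_spread ?r B H)) \<and>
    real (card F1) \<le> real (card F0) + real ((t + Suc M) choose (t - a)) * X"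
    by (rule spread_refinement[OF F(1) S0(1) S0(2)[rule_format] S0(3)[rule_format] S0(4)[rule_format] r X0 Xb])
  then obtain S F1 where S: "F1 \<subseteq> F" "\<forall>A\<in>F - F1. \<exists>B\<in>S. B \<subseteq> A"
    "\<forall>B\<in>S. B \<in> forests n \<and> card B \<le> t + M \<and> (\<exists>H\<subseteq>F. star_spread ?r B H)"
    "real (card F1) \<le> real (card F0) + real ((t + Suc M) choose (t - a)) * X"
    by blast
  have "real ((t + Suc M) choose (t - a)) * X
      = (real ((t + Suc M) choose (t - a)) * (real n * ?r ^ a * (2 / ?r) ^ Suc M)) * ?Q"
    unfolding X_def by (simp only: mult.assoc)
  also have "\<dots> \<le> \<delta> * ?Q" by (rule mult_right_mono[OF Suc.prems(2)]) (use M1 in auto)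
  finally have "real (card F1) \<le> real j * \<delta> * ?Q + \<delta> * ?Q" using S(4) S0(5) by linarith
  also have "\<dots> = real (Suc j) * \<delta> * ?Q" by (simp only: of_nat_Suc distrib_right mult_1 add.commute)
  finally have "real (card F1) \<le> real (Suc j) * \<delta> * ?Q" .
  moreover have "t - a \<le> card (B \<inter> B')" if B: "B \<in> S" "B' \<in> S" for B B'
  proof -
    obtain H H' where H: "H \<subseteq> F" "star_spread ?r B H" and H': "H' \<subseteq> F" "star_spread ?r B' H'"
      using S(3)[rule_format, OF B(1)] S(3)[rule_format, OF B(2)] by (elim conjE exE) (rule that)
    have nr: "n \<ge> 1" "?r > 0" using n r by simp_all
    have "real t \<le> real (card (B \<inter> B')) + 2 * real n / ?r"
      by (rule spread_centers_almost_intersecting[OF F nr H H'])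
    moreover have "2 * real n / ?r = 2 * ?r" using real_div_sqrt[of "real n"] by simp
    ultimately have "real t \<le> real (card (B \<inter> B') + a)" using a by simp
    then have "t \<le> card (B \<inter> B') + a" by (simp only: of_nat_le_iff)
    then show ?thesis by simp
  qed
  then have "\<forall>B\<in>S. \<forall>B'\<in>S. t - a \<le> card (B \<inter> B')" by blast
  moreover have "\<forall>B\<in>S. finite B \<and> card B \<le> t + M" using S(3) forest_finite by blast
  ultimately have "F1 \<subseteq> F \<and> (\<forall>A\<in>F - F1. \<exists>B\<in>S. B \<subseteq> A) \<and> (\<forall>B\<in>S. finite B \<and> card B \<le> t + M) \<and>
    (\<forall>B\<in>S. \<forall>B'\<in>S. t - a \<le> card (B \<inter> B')) \<and> real (card F1) \<le> real (Suc j) * \<delta> * ?Q"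
    using S(1,2) by (intro conjI)
  then show ?case by (intro exI)
qed

section \<open>Estimates\<close>

lemma eventually_powr_dominates:
  fixes c p K :: real
  assumes "c < p"
  shows "eventually (\<lambda>n. K * real n powr c \<le> real n powr p) sequentially"
proof -
  have "eventually (\<lambda>n. max 1 K powr (1 / (p - c)) \<le> real n) sequentially"
    using filterlim_real_sequentially unfolding filterlim_at_top by blast
  then show ?thesis
  proof eventually_elim
    case (elim n)
    have "max 1 K = (max 1 K powr (1 / (p - c))) powr (p - c)" using assms by (simp add: powr_powr)
    also have "\<dots> \<le> real n powr (p - c)" using elim assms by (intro powr_mono2) auto
    finally have "K \<le> real n powr (p - c)" by simp
    then have "K * real n powr c \<le> real n powr (p - c) * real n powr c" by (intro mult_right_mono) auto
    then show ?case by (simp add: powr_add[symmetric])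
  qed
qed

text \<open>One term of the binomial expansion; the free x is tuned later.\<close>

lemma binomial_mult_power_le:
  fixes x :: real
  assumes "x \<ge> 0"
  shows "real (N choose k) * x ^ k \<le> (1 + x) ^ N"
proof (cases "k \<le> N")
  case True
  have "real (N choose k) * x ^ k \<le> (\<Sum>k\<le>N. real (N choose k) * x ^ k)"
    using True assms by (intro member_le_sum) auto
  also have "\<dots> = (x + 1) ^ N" by (simp add: binomial_ring)
  finally show ?thesis by (simp add: add.commute)
qed (use assms in \<open>simp add: binomial_eq_0\<close>)

lemma power_one_plus_le_exp:
  fixes x :: real
  assumes "x \<ge> 0"
  shows "(1 + x) ^ N \<le> exp (real N * x)"
proof -
  have "(1 + x) ^ N \<le> exp x ^ N" using assms by (intro power_mono) (auto simp: exp_ge_add_one_self)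
  then show ?thesis by (simp add: exp_of_nat_mult)
qed

lemma ln_2_bounds: "1/2 \<le> ln (2::real)" "ln (2::real) \<le> 1"
proof -
  have "exp (1/2::real) \<le> 1 + 1/2 + (1/2)\<^sup>2" by (rule exp_bound) auto
  then have "exp (1/2::real) \<le> 2" by (simp add: power2_eq_square)
  then show "1/2 \<le> ln (2::real)" using ln_ge_iff[of 2 "1/2"] by simp
  show "ln (2::real) \<le> 1" using ln_add_one_self_le_self[of 1] by simp
qed

text \<open>Each of the \<open>m\<close> extra edges costs n^(1/4) through the binomial coefficient
  and gains sqrt n / 2; since ln n \<ge> 8, the net gain is at least a factor e. All other terms in
  the exponent are O(n^(3/4)). The denominator 2n lets at most n steps add up to half of the
  error.\<close>

lemma coarse_weight_bound:
  fixes n t m a :: nat and p q :: real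
  assumes L: "8 \<le> ln (real n)" and n: "1 \<le> n" and a: "real a \<le> 2 * sqrt (real n) + 1" "a \<le> t"
    and t: "t \<le> n" and m: "m \<le> n" "real n powr p \<le> real m"
    and dom: "100 * real n powr (3/4) \<le> real n powr p / 2" "real n powr q \<le> real n powr p / 2"
  shows "real ((t + m) choose (t - a)) * (real n * sqrt (real n) ^ a * (2 / sqrt (real n)) ^ m)
    \<le> 2 powr (- (1/2) * real n powr q) / (2 * real n)"
proof -
  define L where "L = ln (real n)"
  define y where "y = real n powr (3/4)"
  have n0: "real n > 0" using n by simp
  have y1: "1 \<le> y" using n by (simp add: y_def ge_one_powr_ge_zero)
  have "L \<le> 4 * real n powr (1/4)" using ln_powr_bound[of "real n" "1/4"] n by (simp add: L_def)
  have sqrt_L: "sqrt (real n) * L \<le> 4 * y"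
  proof -
    have "sqrt (real n) * L \<le> real n powr (1/2) * (4 * real n powr (1/4))"
      using \<open>L \<le> 4 * real n powr (1/4)\<close> n0 by (simp add: powr_half_sqrt)
    also have "\<dots> = 4 * y" by (simp add: y_def powr_add[symmetric])
    finally show ?thesis .
  qed
  have L_y: "L \<le> 4 * y"
  proof -
    have "real n powr (1/4) \<le> y" unfolding y_def using n by (intro powr_mono) auto
    then show ?thesis using \<open>L \<le> 4 * real n powr (1/4)\<close> by linarith
  qed
  have L8: "8 \<le> L" using assms(1) by (simp add: L_def)
  \<comment> \<open>x = n^(-1/4): then (1 + x)^(t + m) is at most exp (2 n^(3/4)), and x^(-1) is the
    cost per element.\<close>
  define x where "x = exp (- L / 4)"
  have x_eq: "real n * x = y"
  proof -
    have "real n = exp L" using n0 by (simp add: L_def)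
    then have "real n * x = exp (L + - L / 4)" by (simp only: x_def exp_add)
    also have "L + - L / 4 = 3/4 * L" by simp
    also have "exp (3/4 * L) = y" using n0 by (simp add: y_def powr_def L_def)
    finally show ?thesis .
  qed
  have sym: "(t + m) choose (t - a) = (t + m) choose (m + a)"
    using binomial_symmetric[of "t - a" "t + m"] a(2) by simp
  have bin: "real ((t + m) choose (t - a)) \<le> exp (2 * y + real (m + a) * (L / 4))"
  proof -
    have "real ((t + m) choose (m + a)) * x ^ (m + a) \<le> (1 + x) ^ (t + m)"
      by (rule binomial_mult_power_le) (simp add: x_def)
    also have "\<dots> \<le> exp (real (t + m) * x)" by (rule power_one_plus_le_exp) (simp add: x_def)
    also have "\<dots> \<le> exp (2 * y)"
    proof -
      have "real (t + m) * x \<le> (2 * real n) * x" using t m by (intro mult_right_mono) (auto simp: x_def)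
      then show ?thesis using x_eq by simp
    qed
    finally have "real ((t + m) choose (m + a)) * x ^ (m + a) \<le> exp (2 * y)" .
    then have "real ((t + m) choose (m + a)) * x ^ (m + a) * exp (real (m + a) * (L / 4))
      \<le> exp (2 * y) * exp (real (m + a) * (L / 4))" by (intro mult_right_mono) auto
    moreover have "x ^ (m + a) * exp (real (m + a) * (L / 4)) = 1"
    proof -
      have "x ^ (m + a) = exp (real (m + a) * (- L / 4))" unfolding x_def by (rule exp_of_nat_mult[symmetric])
      then show ?thesis by (simp add: exp_add[symmetric] del: of_nat_add)
    qed
    ultimately show ?thesis unfolding sym exp_add by (metis mult.assoc mult.right_neutral)
  qed
  have sqrt_exp: "sqrt (real n) = exp (L / 2)" using n0 by (simp add: L_def powr_half_sqrt[symmetric] powr_def)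
  have w: "real n * sqrt (real n) ^ a * (2 / sqrt (real n)) ^ m
     = exp (L + real a * (L / 2) + real m * (ln 2 - L / 2))"
  proof -
    have "2 / sqrt (real n) = exp (ln 2 - L / 2)" by (simp add: sqrt_exp exp_diff)
    then have "(2 / sqrt (real n)) ^ m = exp (real m * (ln 2 - L / 2))" by (simp only: exp_of_nat_mult)
    moreover have "sqrt (real n) ^ a = exp (real a * (L / 2))" by (simp only: sqrt_exp exp_of_nat_mult)
    moreover have "real n = exp L" using n0 by (simp add: L_def)
    ultimately show ?thesis by (simp only: exp_add)
  qed
  have rhs: "2 powr (- (1/2) * real n powr q) / (2 * real n) = exp (- (1/2) * real n powr q * ln 2 - (ln 2 + L))"
    using n0 by (simp add: powr_def[of 2] exp_diff exp_add L_def)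
  have "real ((t + m) choose (t - a)) * (real n * sqrt (real n) ^ a * (2 / sqrt (real n)) ^ m)
    \<le> exp (2 * y + real (m + a) * (L / 4)) * exp (L + real a * (L / 2) + real m * (ln 2 - L / 2))"
    unfolding w by (rule mult_right_mono[OF bin]) simp
  also have "\<dots> = exp ((2 * y + real (m + a) * (L / 4)) + (L + real a * (L / 2) + real m * (ln 2 - L / 2)))"
    by (simp only: exp_add)
  also have "\<dots> \<le> exp (- (1/2) * real n powr q * ln 2 - (ln 2 + L))"
  proof -
    have ln2: "0 < ln (2::real)" "ln (2::real) \<le> 1" using ln_2_bounds by auto
    have "real n powr p \<le> real m * 1" using m by simp
    also have "\<dots> \<le> real m * (L / 4 - ln 2)" using L8 ln2 by (intro mult_left_mono) auto
    finally have "real n powr p \<le> real m * (L / 4) - real m * ln 2" by (simp add: algebra_simps)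
    moreover have "real a * L \<le> 12 * y"
    proof -
      have "real a * L \<le> (2 * sqrt (real n) + 1) * L" using a L8 by (intro mult_right_mono) auto
      also have "\<dots> = 2 * (sqrt (real n) * L) + L" by (simp add: algebra_simps)
      finally show ?thesis using sqrt_L L_y by linarith
    qed
    moreover have "real n powr q * ln 2 \<le> real n powr q" using ln2 by (simp add: mult_left_le)
    moreover have "100 * y \<le> real n powr p / 2" using dom(1) by (simp add: y_def)
    moreover have "real (m + a) * (L / 4) = real m * (L / 4) + real a * L / 4" by (simp add: algebra_simps)
    moreover have "real m * (ln 2 - L / 2) = real m * ln 2 - 2 * (real m * (L / 4))" by (simp add: algebra_simps)
    moreover have "real a * (L / 2) = real a * L / 2" by simp
    ultimately have "(2 * y + real (m + a) * (L / 4)) + (L + real a * (L / 2) + real m * (ln 2 - L / 2))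
       \<le> - (1/2) * (real n powr q * ln 2) - (ln 2 + L)"
      using dom(2) L_y y1 ln2 by linarith
    then show ?thesis by (simp add: mult.assoc)
  qed
  finally show ?thesis unfolding rhs .
qed

text \<open>Since r \<le> n/4, the guaranteed gain is only 2^(-k). The crude estimate n^(2(M + a))
  for the binomial coefficient is enough, because M and a are O(n^p) and n^p ln n is small compared
  with k.\<close>

lemma fine_weight_bound:
  fixes n t M a k :: nat and p q q' r :: real
  assumes L: "1 \<le> ln (real n)" and n: "2 \<le> n" and a: "real a \<le> 2 * sqrt (real n) + 1" "a \<le> t"
    and t: "t \<le> n" and M: "M \<le> n" "real M \<le> real n powr p + 1" and p: "1/2 \<le> p" "q' \<le> p"
    and k: "real n powr q \<le> real k" and r: "0 \<le> r" "r \<le> real n / 4"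
    and dom: "64 * ln (real n) * real n powr p \<le> real n powr q"
  shows "real ((t + M) choose (t - a)) * (real n * r ^ a * (2 * r / real n) ^ k)
    \<le> 2 powr (- (1/2) * real n powr q') / 2"
proof -
  define L where "L = ln (real n)"
  define z where "z = real n powr p"
  have n0: "real n > 0" using n by simp
  have L1: "1 \<le> L" using L by (simp add: L_def)
  have z1: "1 \<le> z" unfolding z_def using n p by (intro ge_one_powr_ge_zero) auto
  have zs: "sqrt (real n) \<le> z"
    unfolding z_def powr_half_sqrt[of "real n", symmetric, simplified] using n p by (intro powr_mono) auto
  have zq: "real n powr q' \<le> z" unfolding z_def using n p by (intro powr_mono) auto
  have eL: "real n = exp L" using n0 by (simp add: L_def)
  have sym: "(t + M) choose (t - a) = (t + M) choose (M + a)"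
    using binomial_symmetric[of "t - a" "t + M"] a(2) by simp
  have "real ((t + M) choose (M + a)) \<le> real ((t + M) ^ (M + a))"
    using binomial_le_pow[of "M + a" "t + M"] a(2) by (intro of_nat_mono) simp
  also have "\<dots> \<le> (real n ^ 2) ^ (M + a)"
  proof -
    have "real (t + M) \<le> 2 * real n" using t M by simp
    also have "\<dots> \<le> real n * real n" using n by (intro mult_right_mono) auto
    finally show ?thesis by (simp add: power2_eq_square power_mono)
  qed
  also have "\<dots> = exp (real (M + a) * (2 * L))"
  proof -
    have "real n ^ 2 = exp (2 * L)" unfolding eL by (simp add: power2_eq_square exp_add[symmetric])
    then show ?thesis by (simp only: exp_of_nat_mult)
  qed
  finally have bin: "real ((t + M) choose (t - a)) \<le> exp (real (M + a) * (2 * L))" unfolding sym .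
  have "real n * r ^ a * (2 * r / real n) ^ k \<le> real n * real n ^ a * (1/2) ^ k"
    using r n0 by (intro mult_mono power_mono) (auto simp: field_simps)
  also have "\<dots> = exp (L + real a * L + real k * (- ln 2))"
  proof -
    have "(1/2::real) = exp (- ln 2)" by (simp add: exp_minus)
    then have "(1/2::real) ^ k = exp (real k * (- ln 2))" by (simp only: exp_of_nat_mult)
    moreover have "real n ^ a = exp (real a * L)" by (simp only: eL exp_of_nat_mult)
    ultimately show ?thesis by (simp only: exp_add eL)
  qed
  finally have w: "real n * r ^ a * (2 * r / real n) ^ k \<le> exp (L + real a * L + real k * (- ln 2))" .
  have "real ((t + M) choose (t - a)) * (real n * r ^ a * (2 * r / real n) ^ k)
    \<le> exp (real (M + a) * (2 * L)) * exp (L + real a * L + real k * (- ln 2))"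
    using bin w r by (intro mult_mono) auto
  also have "\<dots> = exp (real (M + a) * (2 * L) + (L + real a * L + real k * (- ln 2)))" by (simp only: exp_add)
  also have "\<dots> \<le> exp (- (1/2) * real n powr q' * ln 2 - ln 2)"
  proof -
    note ln2 = ln_2_bounds
    have aL: "real a * L \<le> (3 * z) * L" using a zs z1 L1 by (intro mult_right_mono) auto
    have MzL: "real M * L \<le> (2 * z) * L" using M z1 L1 by (intro mult_right_mono) (auto simp: z_def)
    have aL': "real a * L \<le> 3 * (z * L)" and MzL': "real M * L \<le> 2 * (z * L)"
      using aL MzL by (simp_all only: mult.assoc)
    have LzL: "L \<le> z * L" "z \<le> z * L" using z1 L1 by auto
    have "32 * (z * L) \<le> real n powr q * (1/2)" using dom by (simp add: z_def L_def mult_ac)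
    also have "\<dots> \<le> real k * ln 2" using k ln2 by (intro mult_mono) auto
    finally have "32 * (z * L) \<le> real k * ln 2" .
    moreover have "real n powr q' * ln 2 \<le> real n powr q'" using ln2 by (simp add: mult_left_le)
    moreover have "real k * (- ln 2) = - (real k * ln 2)" by simp
    moreover have "real (M + a) * (2 * L) = 2 * (real M * L) + 2 * (real a * L)" by (simp add: algebra_simps)
    ultimately have "real (M + a) * (2 * L) + (L + real a * L + real k * (- ln 2))
      \<le> - (1/2) * (real n powr q' * ln 2) - ln 2"
      using aL' MzL' LzL zq ln2 z1 by linarith
    then show ?thesis by (simp add: mult.assoc)
  qed
  also have "\<dots> = 2 powr (- (1/2) * real n powr q') / 2" by (simp add: powr_def[of 2] exp_diff)
  finally show ?thesis .
qed

text \<open>The first round needs h of order n/r, the second needs h small compared with r. With r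
  \<ge> 4 n^(3/4) the former is O(n^(1/4)), so both can be met.\<close>

lemma spread_parameters:
  fixes n :: nat and r q :: real
  assumes n: "real n \<ge> 10 ^ 10" and r: "4 * real n powr q \<le> r" "4 * real n powr (3/4) \<le> r"
  shows "real n powr q + 2 * real n / r \<le> r / 2"
    and "\<exists>h. 20 * (1 + 12 / r) ^ n \<le> 2 ^ h \<and> (1 + 16 / r) ^ h \<le> 11 / 10"
proof -
  define s where "s = real n powr (1/4)"
  have n1: "real n \<ge> 1" using n by simp
  have s0: "s > 0" using n1 by (simp add: s_def)
  have s4: "s ^ 4 = real n" using n1 by (simp add: s_def powr_realpow[symmetric] powr_powr)
  have s3: "s ^ 3 = real n powr (3/4)" using n1 by (simp add: s_def powr_realpow[symmetric] powr_powr)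
  have s100: "s \<ge> 100"
  proof (rule ccontr)
    assume "\<not> 100 \<le> s"
    then have "s ^ 4 < 100 ^ 4" using s0 by (intro power_strict_mono) auto
    then show False using s4 n by simp
  qed
  have rs: "4 * s ^ 3 \<le> r" using r s3 by simp
  have s3s: "s \<le> s ^ 3" using s100 by (intro self_le_power) auto
  have r0: "r > 0" using rs s0 by (smt (verit) zero_less_power)
  have nr: "real n / r \<le> s / 4"
  proof -
    have "real n = s / 4 * (4 * s ^ 3)" by (simp add: s4[symmetric] power4_eq_xxxx power3_eq_cube)
    also have "\<dots> \<le> s / 4 * r" using rs s0 by (intro mult_left_mono) auto
    finally show ?thesis using r0 by (simp add: field_simps)
  qed
  have "2 * real n / r = 2 * (real n / r)" by simp
  then show "real n powr q + 2 * real n / r \<le> r / 2" using nr r rs s3s s0 by linarith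
  \<comment> \<open>20 \<le> 2^5 gives the 5, and exp (12 n/r) \<le> 2^(24 n/r) by ln 2 \<ge> 1/2
    gives the 24.\<close>
  define h where "h = nat \<lceil>24 * (real n / r)\<rceil> + 5"
  have h: "24 * (real n / r) + 5 \<le> real h" "real h \<le> 24 * (real n / r) + 6"
    unfolding h_def using r0 by (auto simp: of_nat_nat) linarith+
  have "20 * (1 + 12 / r) ^ n \<le> 2 ^ h"
  proof -
    have "20 * (1 + 12 / r) ^ n \<le> 2 ^ 5 * exp (real n * (12 / r))"
      using r0 by (intro mult_mono power_one_plus_le_exp) auto
    also have "\<dots> \<le> exp (5 * ln 2) * exp (24 * (real n / r) * ln 2)"
    proof (intro mult_mono)
      have "(2::real) ^ 5 = exp (real 5 * ln 2)" by (simp only: exp_of_nat_mult exp_ln)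
      then show "(2::real) ^ 5 \<le> exp (5 * ln 2)" by simp
      have "12 * (real n / r) = 24 * (real n / r) * (1/2)" by simp
      also have "\<dots> \<le> 24 * (real n / r) * ln 2" using ln_2_bounds(1) r0 by (intro mult_left_mono) auto
      finally show "exp (real n * (12 / r)) \<le> exp (24 * (real n / r) * ln 2)" by (simp add: mult.commute)
    qed auto
    also have "\<dots> = exp ((24 * (real n / r) + 5) * ln 2)" by (simp add: exp_add[symmetric] algebra_simps)
    also have "\<dots> \<le> exp (real h * ln 2)" using h(1) by (simp add: mult_right_mono)
    also have "\<dots> = 2 ^ h" by (simp only: exp_of_nat_mult exp_ln)
    finally show ?thesis .
  qed
  moreover have "(1 + 16 / r) ^ h \<le> 11 / 10"
  proof -
    have "(1 + 16 / r) ^ h \<le> exp (real h * (16 / r))" using r0 by (intro power_one_plus_le_exp) auto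
    also have "\<dots> \<le> exp (1 / 20)"
    proof -
      have "24 * (real n / r) \<le> 24 * (s / 4)" by (rule mult_left_mono[OF nr]) simp
      also have "24 * (s / 4) = 6 * s" by simp
      finally have "real h \<le> 6 * s + 6" using h(2) by linarith
      then have "320 * real h \<le> 1920 * s + 1920" by linarith
      also have "\<dots> \<le> 2000 * s" using s100 by linarith
      also have "\<dots> \<le> s ^ 2 * s"
      proof -
        have "(2000::real) \<le> s * s" using s100 by (intro order_trans[OF _ mult_mono[of 100 s 100 s]]) auto
        then show ?thesis using s0 by (simp add: power2_eq_square)
      qed
      also have "\<dots> \<le> r" using rs s0 by (simp add: power2_eq_square power3_eq_cube) 
          (smt (verit) mult_pos_pos)
      finally show ?thesis using r0 by (simp add: field_simps)
    qed
    also have "\<dots> \<le> 1 + 1/20 + (1/20)\<^sup>2" by (rule exp_bound) auto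
    also have "\<dots> \<le> 11 / 10" by (simp add: power2_eq_square)
    finally show ?thesis .
  qed
  ultimately show "\<exists>h. 20 * (1 + 12 / r) ^ n \<le> 2 ^ h \<and> (1 + 16 / r) ^ h \<le> 11 / 10" by blast
qed

text \<open>The error is split evenly between the coarse phase and the last step. Of the conditions
  \<open>dom\<close>, two serve the coarse phase, one the last step, two make r large enough for
  exact intersection, and one gives a \<le> t.\<close>

lemma spread_approximation_of_trees:
  fixes \<epsilon> :: real and n t :: nat
  assumes \<epsilon>: "0 < \<epsilon>" "\<epsilon> < 1/40" and n: "t + 2 \<le> n" "real n \<ge> 10 ^ 10" "8 \<le> ln (real n)"
    and t: "2 * real n powr (1 - \<epsilon> / 7) \<le> real t"
    and F: "F \<subseteq> spanning_trees n" "t_intersecting t F"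
    and dom: "200 * real n powr (3/4) \<le> real n powr (1 - \<epsilon> / 5)"
      "2 * real n powr (1 - \<epsilon> / 4) \<le> real n powr (1 - \<epsilon> / 5)"
      "(3840 / \<epsilon>) * real n powr (1 - \<epsilon> / 5 + \<epsilon> / 60) \<le> real n powr (1 - \<epsilon> / 6)"
      "(1 / (5 * \<epsilon>)) * real n powr (1 - \<epsilon> / 6) \<le> real n powr (1 - \<epsilon> / 7)"
      "(1 / (5 * \<epsilon>)) * real n powr (3/4) \<le> real n powr (1 - \<epsilon> / 7)"
      "3 * real n powr (1/2) \<le> real n powr (1 - \<epsilon> / 7)"
  shows "\<exists>\<S> \<F>'. \<S> \<subseteq> forests n \<and> t_intersecting t \<S> \<and>
          (\<forall>B\<in>\<S>. real (card B) \<le> real t + real n powr (1 - \<epsilon> / 6)) \<and> \<F>' \<subseteq> F \<and>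
          F - \<F>' \<subseteq> fam_stars (spanning_trees n) \<S> \<and>
          (\<forall>B\<in>\<S>. \<exists>\<F>\<^sub>B. \<F>\<^sub>B \<subseteq> F \<and> spread (K_edges n) (10 * \<epsilon> * real t) (fam_link \<F>\<^sub>B B)) \<and>
          real (card \<F>') \<le> 2 powr (- (1/2) * real n powr (1 - \<epsilon> / 4)) * real (c_max n t) * real n ^ (n - 2 - t)"
proof -
  let ?Q = "real (c_max n t) * real n ^ (n - 2 - t)"
  define r where "r = 10 * \<epsilon> * real t"
  define D where "D = 2 powr (- (1/2) * real n powr (1 - \<epsilon> / 4))"
  define a where "a = nat \<lceil>2 * sqrt (real n)\<rceil>"
  define M where "M = nat \<lceil>real n powr (1 - \<epsilon> / 5)\<rceil>"
  \<comment> \<open>Rounding down keeps t + m within the allowed size, while a stuck forest has at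
    least \<open>Suc m\<close> extra edges, which is at least n^(1 - \<epsilon>/6).\<close>
  define m where "m = nat \<lfloor>real n powr (1 - \<epsilon> / 6)\<rfloor>"
  have n1: "real n \<ge> 1" "n \<ge> 1" "n \<ge> 4" "n \<ge> 2" using n(2) by simp_all
  have tn: "t \<le> n" "real t \<le> real n" using n(1) by simp_all
  have a: "2 * sqrt (real n) \<le> real a" "real a \<le> 2 * sqrt (real n) + 1"
    unfolding a_def by (simp_all add: real_nat_ceiling_ge)
  have at: "a \<le> t"
  proof -
    have "1 \<le> sqrt (real n)" using n1 by simp
    then have "real a \<le> 3 * sqrt (real n)" using a(2) by linarith
    also have "\<dots> \<le> real n powr (1 - \<epsilon> / 7)" using dom(6) by (simp add: powr_half_sqrt)
    also have "\<dots> \<le> real t" using t by simp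
    finally show ?thesis by simp
  qed
  have M: "real n powr (1 - \<epsilon> / 5) \<le> real M" "real M \<le> real n powr (1 - \<epsilon> / 5) + 1"
    unfolding M_def by (simp_all add: real_nat_ceiling_ge)
  have Mn: "M \<le> n"
  proof -
    have "real n powr (1 - \<epsilon> / 5) \<le> real n powr 1" using \<epsilon> n1 by (intro powr_mono) auto
    then show ?thesis unfolding M_def using n1 by (simp add: nat_le_iff ceiling_le_iff)
  qed
  have m: "real m \<le> real n powr (1 - \<epsilon> / 6)" "real n powr (1 - \<epsilon> / 6) \<le> real (Suc m)"
    unfolding m_def by (simp_all add: of_nat_floor) linarith
  have r_ge: "4 * real n powr (1 - \<epsilon> / 6) \<le> r" "4 * real n powr (3/4) \<le> r"
  proof -
    \<comment> \<open>The lower bound on \<open>t\<close> gives r \<ge> 20 \<epsilon> n^(1 -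
      \<epsilon>/7); 4 / (20 \<epsilon>) is the constant 1 / (5 \<epsilon>) in
      \<open>dom\<close>.\<close>
    have y: "20 * \<epsilon> * real n powr (1 - \<epsilon> / 7) \<le> r"
      using mult_left_mono[OF t, of "10 * \<epsilon>"] \<epsilon> by (simp add: r_def mult_ac)
    have x: "4 * x \<le> 20 * \<epsilon> * y" if "(1 / (5 * \<epsilon>)) * x \<le> y" for x y :: real
      using mult_left_mono[OF that, of "20 * \<epsilon>"] \<epsilon> by simp
    show "4 * real n powr (1 - \<epsilon> / 6) \<le> r" "4 * real n powr (3/4) \<le> r"
      using order_trans[OF x[OF dom(4)] y] order_trans[OF x[OF dom(5)] y] .
  qed
  have r1: "r > 1"
  proof -
    have "1 \<le> real n powr (3/4)" using n1 by (intro ge_one_powr_ge_zero) auto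
    then show ?thesis using r_ge(2) by linarith
  qed
  \<comment> \<open>The bound 1/40 on \<epsilon> is chosen for this: it keeps 2r/n at most
    1/2.\<close>
  have r4: "r \<le> real n / 4"
  proof -
    have "10 * \<epsilon> * real t \<le> (1/4) * real n" using \<epsilon> tn by (intro mult_mono) auto
    then show ?thesis by (simp add: r_def)
  qed
  have coarse: "\<exists>S F1. F1 \<subseteq> F \<and> (\<forall>A\<in>F - F1. \<exists>B\<in>S. B \<subseteq> A) \<and> (\<forall>B\<in>S. finite B \<and> card B \<le> t + M) \<and>
    (\<forall>B\<in>S. \<forall>B'\<in>S. t - a \<le> card (B \<inter> B')) \<and> real (card F1) \<le> real (n - M) * (D / (2 * real n)) * ?Q"
  proof (rule coarse_approximation[OF F n(1) n1(3) a(1)])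
    show "0 \<le> D / (2 * real n)" by (simp add: D_def)
    show "M + (n - M) = n" using Mn by simp
    fix k assume k: "M < k" "k \<le> n"
    have "real n powr (1 - \<epsilon> / 5) \<le> real k" using M(1) k(1) by simp
    then show "real ((t + k) choose (t - a)) * (real n * sqrt (real n) ^ a * (2 / sqrt (real n)) ^ k) \<le> D / (2 * real n)"
      unfolding D_def using dom(1,2) by (intro coarse_weight_bound[OF n(3) n1(2) a(2) at tn(1) k(2)]) auto
  qed
  then obtain S0 F0 where S0: "F0 \<subseteq> F" "\<forall>A\<in>F - F0. \<exists>B\<in>S0. B \<subseteq> A" "\<forall>B\<in>S0. finite B \<and> card B \<le> t + M"
    "\<forall>B\<in>S0. \<forall>B'\<in>S0. t - a \<le> card (B \<inter> B')" "real (card F0) \<le> real (n - M) * (D / (2 * real n)) * ?Q"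
    by blast
  have F0: "real (card F0) \<le> D / 2 * ?Q"
  proof -
    have "real (n - M) * (D / (2 * real n)) \<le> real n * (D / (2 * real n))" by (intro mult_right_mono) (auto simp: D_def)
    also have "\<dots> = D / 2" using n1 by simp
    finally have "real (n - M) * (D / (2 * real n)) * ?Q \<le> D / 2 * ?Q" by (intro mult_right_mono) auto
    then show ?thesis using S0(5) by linarith
  qed
  define X where "X = real n * r ^ a * (2 * r / real n) ^ Suc m * ?Q"
  have X0: "X \<ge> 0" unfolding X_def using r1 by simp
  have Xb: "r ^ (card B - (t - a)) * real (card (fam_star (spanning_trees n) B)) \<le> X"
    if "B \<in> forests n" "t + m < card B" for B
  proof -
    have "t - (t - a) = a" using at by simp
    then show ?thesis unfolding X_def
      using tree_weight_bound[of B n t "Suc m" r "t - a"] that n(1) r1 r4 by simp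
  qed
  have "\<exists>S F1. F1 \<subseteq> F \<and> (\<forall>A\<in>F - F1. \<exists>B\<in>S. B \<subseteq> A) \<and>
    (\<forall>B\<in>S. B \<in> forests n \<and> card B \<le> t + m \<and> (\<exists>H\<subseteq>F. star_spread r B H)) \<and>
    real (card F1) \<le> real (card F0) + real ((t + M) choose (t - a)) * X"
    by (rule spread_refinement[OF F(1) S0(1) S0(2)[rule_format] S0(3)[rule_format] S0(4)[rule_format] r1 X0 Xb])
  then obtain S F1 where S: "F1 \<subseteq> F" "\<forall>A\<in>F - F1. \<exists>B\<in>S. B \<subseteq> A"
    "\<forall>B\<in>S. B \<in> forests n \<and> card B \<le> t + m \<and> (\<exists>H\<subseteq>F. star_spread r B H)"
    "real (card F1) \<le> real (card F0) + real ((t + M) choose (t - a)) * X"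
    by blast
  have fine: "real ((t + M) choose (t - a)) * (real n * r ^ a * (2 * r / real n) ^ Suc m) \<le> D / 2"
    unfolding D_def
  proof (rule fine_weight_bound[OF _ n1(4) a(2) at tn(1) Mn M(2) _ _ m(2) _ r4])
    \<comment> \<open>The logarithm is replaced by (60/\<epsilon>) n^(\<epsilon>/60), and 64 * 60 =
      3840. The exponent stays below the target because 1/5 - 1/60 = 11/60 > 1/6.\<close>
    show "64 * ln (real n) * real n powr (1 - \<epsilon> / 5) \<le> real n powr (1 - \<epsilon> / 6)"
    proof -
      have "ln (real n) \<le> real n powr (\<epsilon> / 60) / (\<epsilon> / 60)" using n1 \<epsilon> by (intro ln_powr_bound) auto
      then have "64 * ln (real n) \<le> 64 * (real n powr (\<epsilon> / 60) / (\<epsilon> / 60))" by simp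
      also have "\<dots> = 3840 / \<epsilon> * real n powr (\<epsilon> / 60)" by simp
      finally have "64 * ln (real n) * real n powr (1 - \<epsilon> / 5)
        \<le> 3840 / \<epsilon> * real n powr (\<epsilon> / 60) * real n powr (1 - \<epsilon> / 5)" by (intro mult_right_mono) auto
      also have "\<dots> = 3840 / \<epsilon> * real n powr (1 - \<epsilon> / 5 + \<epsilon> / 60)"
        by (simp only: mult.assoc powr_add[symmetric] add.commute)
      finally show ?thesis using dom(3) by linarith
    qed
  qed (use n(3) r1 \<epsilon> in auto)
  have cF1: "real (card F1) \<le> D * ?Q"
  proof -
    have "real ((t + M) choose (t - a)) * X
      = (real ((t + M) choose (t - a)) * (real n * r ^ a * (2 * r / real n) ^ Suc m)) * ?Q"
      unfolding X_def by (simp only: mult.assoc)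
    also have "\<dots> \<le> D / 2 * ?Q" by (rule mult_right_mono[OF fine]) simp
    finally have "real (card F1) \<le> D / 2 * ?Q + D / 2 * ?Q" using S(4) F0 by linarith
    then show ?thesis by simp
  qed
  obtain h where h: "20 * (1 + 12 / r) ^ n \<le> 2 ^ h" "(1 + 16 / r) ^ h \<le> 11 / 10"
    using spread_parameters(2)[OF n(2) r_ge] by blast
  have size: "real (card B) \<le> real t + real n powr (1 - \<epsilon> / 6)" if "B \<in> S" for B
  proof -
    have "card B \<le> t + m" using S(3) that by blast
    then have "real (card B) \<le> real (t + m)" by (rule of_nat_mono)
    then show ?thesis using m(1) by simp
  qed
  have "t_intersecting t S"
    unfolding t_intersecting_def
  proof (intro ballI)
    fix B B' assume B: "B \<in> S" "B' \<in> S"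
    obtain H where H: "H \<subseteq> F" "star_spread r B H" using S(3) B(1) by blast
    obtain H' where H': "H' \<subseteq> F" "star_spread r B' H'" using S(3) B(2) by blast
    have r0: "r > 0" using r1 by simp
    show "t \<le> card (B \<inter> B')"
      by (rule spread_centers_intersecting[OF F n1(2) r0 H H' size[OF B(1)] size[OF B(2)]
            spread_parameters(1)[OF n(2) r_ge] h])
  qed
  moreover have "S \<subseteq> forests n" using S(3) by blast
  moreover have "F - F1 \<subseteq> fam_stars (spanning_trees n) S"
    using S(2) F(1) by (fastforce simp: fam_stars_def fam_star_def)
  moreover have "\<forall>B\<in>S. \<exists>\<F>\<^sub>B. \<F>\<^sub>B \<subseteq> F \<and> spread (K_edges n) (10 * \<epsilon> * real t) (fam_link \<F>\<^sub>B B)"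
  proof
    fix B assume "B \<in> S"
    then obtain H where H: "H \<subseteq> F" "star_spread r B H" using S(3) by blast
    then have "spread (K_edges n) r (fam_link H B)" using spread_fam_link r1 finite_K_edges by blast
    then show "\<exists>\<F>\<^sub>B. \<F>\<^sub>B \<subseteq> F \<and> spread (K_edges n) (10 * \<epsilon> * real t) (fam_link \<F>\<^sub>B B)"
      using H(1) unfolding r_def by blast
  qed
  moreover have "\<forall>B\<in>S. real (card B) \<le> real t + real n powr (1 - \<epsilon> / 6)" using size by blast
  moreover have "real (card F1) \<le> 2 powr (- (1/2) * real n powr (1 - \<epsilon> / 4)) * real (c_max n t) * real n ^ (n - 2 - t)"
    using cF1 unfolding D_def by (simp only: mult.assoc)
  ultimately have "S \<subseteq> forests n \<and> t_intersecting t S \<and>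
          (\<forall>B\<in>S. real (card B) \<le> real t + real n powr (1 - \<epsilon> / 6)) \<and> F1 \<subseteq> F \<and>
          F - F1 \<subseteq> fam_stars (spanning_trees n) S \<and>
          (\<forall>B\<in>S. \<exists>\<F>\<^sub>B. \<F>\<^sub>B \<subseteq> F \<and> spread (K_edges n) (10 * \<epsilon> * real t) (fam_link \<F>\<^sub>B B)) \<and>
          real (card F1) \<le> 2 powr (- (1/2) * real n powr (1 - \<epsilon> / 4)) * real (c_max n t) * real n ^ (n - 2 - t)"
    using S(1) by (intro conjI)
  then show ?thesis by (intro exI)
qed

theorem theorem23:
  shows "\<exists>\<epsilon>0 > 0. \<forall>\<epsilon>::real. 0 < \<epsilon> \<and> \<epsilon> < \<epsilon>0 \<longrightarrow>
    (\<exists>n0 t0 :: nat. \<forall>n > n0. \<forall>t :: nat. \<forall>\<F>.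
       t \<ge> 1 \<and> 2 * real n powr (1 - \<epsilon> / 7) \<le> real t \<and> t + 2 \<le> n \<and> t > t0 \<and>
       \<F> \<subseteq> spanning_trees n \<and> t_intersecting t \<F> \<longrightarrow>
       (\<exists>\<S> \<F>'.
          \<S> \<subseteq> forests n \<and> t_intersecting t \<S> \<and>
          (\<forall>B\<in>\<S>. real (card B) \<le> real t + real n powr (1 - \<epsilon> / 6)) \<and>
          \<F>' \<subseteq> \<F> \<and>
          \<F> - \<F>' \<subseteq> fam_stars (spanning_trees n) \<S> \<and>
          (\<forall>B\<in>\<S>. \<exists>\<F>\<^sub>B. \<F>\<^sub>B \<subseteq> \<F> \<and>
             spread (K_edges n) (10 * \<epsilon> * real t) (fam_link \<F>\<^sub>B B)) \<and>
          real (card \<F>') \<le> 2 powr (- (1/2) * real n powr (1 - \<epsilon> / 4))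
             * real (c_max n t) * real n ^ (n - 2 - t)))"
proof (intro exI[of _ "1/40::real"] conjI allI impI)
  show "(0::real) < 1/40" by simp
  fix \<epsilon> :: real assume "0 < \<epsilon> \<and> \<epsilon> < 1/40"
  then have \<epsilon>: "0 < \<epsilon>" "\<epsilon> < 1/40" by auto
  have "eventually (\<lambda>n. 10 ^ 10 \<le> real n) sequentially"
    using filterlim_real_sequentially unfolding filterlim_at_top by blast
  moreover have "eventually (\<lambda>n. 8 \<le> ln (real n)) sequentially"
    using filterlim_compose[OF ln_at_top filterlim_real_sequentially] unfolding filterlim_at_top by blast
  \<comment> \<open>Each inequality only compares exponents: 1/4 > 1/5 > 11/60 > 1/6 > 1/7 orders
    the multiples of \<epsilon>, and 1/2 and 3/4 lie below the exponents near 1 since \<epsilon> is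
    small.\<close>
  moreover have "eventually (\<lambda>n. 200 * real n powr (3/4) \<le> real n powr (1 - \<epsilon> / 5)) sequentially"
    "eventually (\<lambda>n. 2 * real n powr (1 - \<epsilon> / 4) \<le> real n powr (1 - \<epsilon> / 5)) sequentially"
    "eventually (\<lambda>n. (3840 / \<epsilon>) * real n powr (1 - \<epsilon> / 5 + \<epsilon> / 60) \<le> real n powr (1 - \<epsilon> / 6)) sequentially"
    "eventually (\<lambda>n. (1 / (5 * \<epsilon>)) * real n powr (1 - \<epsilon> / 6) \<le> real n powr (1 - \<epsilon> / 7)) sequentially"
    "eventually (\<lambda>n. (1 / (5 * \<epsilon>)) * real n powr (3/4) \<le> real n powr (1 - \<epsilon> / 7)) sequentially"
    "eventually (\<lambda>n. 3 * real n powr (1/2) \<le> real n powr (1 - \<epsilon> / 7)) sequentially"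
    by (rule eventually_powr_dominates; use \<epsilon> in linarith)+
  ultimately have "eventually (\<lambda>n. 10 ^ 10 \<le> real n \<and> 8 \<le> ln (real n) \<and>
      200 * real n powr (3/4) \<le> real n powr (1 - \<epsilon> / 5) \<and>
      2 * real n powr (1 - \<epsilon> / 4) \<le> real n powr (1 - \<epsilon> / 5) \<and>
      (3840 / \<epsilon>) * real n powr (1 - \<epsilon> / 5 + \<epsilon> / 60) \<le> real n powr (1 - \<epsilon> / 6) \<and>
      (1 / (5 * \<epsilon>)) * real n powr (1 - \<epsilon> / 6) \<le> real n powr (1 - \<epsilon> / 7) \<and>
      (1 / (5 * \<epsilon>)) * real n powr (3/4) \<le> real n powr (1 - \<epsilon> / 7) \<and>
      3 * real n powr (1/2) \<le> real n powr (1 - \<epsilon> / 7)) sequentially"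
    by (intro eventually_conj)
  then obtain n0 where n0: "\<And>n. n \<ge> n0 \<Longrightarrow> 10 ^ 10 \<le> real n \<and> 8 \<le> ln (real n) \<and>
      200 * real n powr (3/4) \<le> real n powr (1 - \<epsilon> / 5) \<and>
      2 * real n powr (1 - \<epsilon> / 4) \<le> real n powr (1 - \<epsilon> / 5) \<and>
      (3840 / \<epsilon>) * real n powr (1 - \<epsilon> / 5 + \<epsilon> / 60) \<le> real n powr (1 - \<epsilon> / 6) \<and>
      (1 / (5 * \<epsilon>)) * real n powr (1 - \<epsilon> / 6) \<le> real n powr (1 - \<epsilon> / 7) \<and>
      (1 / (5 * \<epsilon>)) * real n powr (3/4) \<le> real n powr (1 - \<epsilon> / 7) \<and>
      3 * real n powr (1/2) \<le> real n powr (1 - \<epsilon> / 7)"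
    unfolding eventually_sequentially by blast
  show "\<exists>n0 t0 :: nat. \<forall>n > n0. \<forall>t :: nat. \<forall>\<F>.
       t \<ge> 1 \<and> 2 * real n powr (1 - \<epsilon> / 7) \<le> real t \<and> t + 2 \<le> n \<and> t > t0 \<and>
       \<F> \<subseteq> spanning_trees n \<and> t_intersecting t \<F> \<longrightarrow>
       (\<exists>\<S> \<F>'.
          \<S> \<subseteq> forests n \<and> t_intersecting t \<S> \<and>
          (\<forall>B\<in>\<S>. real (card B) \<le> real t + real n powr (1 - \<epsilon> / 6)) \<and>
          \<F>' \<subseteq> \<F> \<and>
          \<F> - \<F>' \<subseteq> fam_stars (spanning_trees n) \<S> \<and>
          (\<forall>B\<in>\<S>. \<exists>\<F>\<^sub>B. \<F>\<^sub>B \<subseteq> \<F> \<and>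
             spread (K_edges n) (10 * \<epsilon> * real t) (fam_link \<F>\<^sub>B B)) \<and>
          real (card \<F>') \<le> 2 powr (- (1/2) * real n powr (1 - \<epsilon> / 4))
             * real (c_max n t) * real n ^ (n - 2 - t))"
  proof (rule exI[of _ n0], rule exI[of _ 0], intro allI impI, elim conjE)
    fix n t :: nat and \<F>
    assume "n0 < n" and t: "2 * real n powr (1 - \<epsilon> / 7) \<le> real t" "t + 2 \<le> n"
      and F: "\<F> \<subseteq> spanning_trees n" "t_intersecting t \<F>"
    note big = n0[OF less_imp_le[OF \<open>n0 < n\<close>]]
    show "\<exists>\<S> \<F>'.
          \<S> \<subseteq> forests n \<and> t_intersecting t \<S> \<and>
          (\<forall>B\<in>\<S>. real (card B) \<le> real t + real n powr (1 - \<epsilon> / 6)) \<and>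
          \<F>' \<subseteq> \<F> \<and>
          \<F> - \<F>' \<subseteq> fam_stars (spanning_trees n) \<S> \<and>
          (\<forall>B\<in>\<S>. \<exists>\<F>\<^sub>B. \<F>\<^sub>B \<subseteq> \<F> \<and>
             spread (K_edges n) (10 * \<epsilon> * real t) (fam_link \<F>\<^sub>B B)) \<and>
          real (card \<F>') \<le> 2 powr (- (1/2) * real n powr (1 - \<epsilon> / 4))
             * real (c_max n t) * real n ^ (n - 2 - t)"
      by (rule spread_approximation_of_trees[OF \<epsilon> t(2) _ _ t(1) F]) (use big in simp_all)
  qed
qed

end
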